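(* Let $n=1$ and $T_{\mathrm{s}}>0$. Let $\partial\Gamma_k$ be a simple closed contour in $\mathbb{R}^2$, let $\Gamma_k$ be the set of points enclosed by $\partial\Gamma_k$, and let $A_k:=\int_{\Gamma_k}\mathrm{d}q_k\wedge\mathrm{d}p_k$ be the corresponding signed area. The map $\psi:(q_k,p_k)\mapsto(q_{k+1},p_{k+1})$ given by $$p_{k+1}=p_k+T_{\mathrm{s}}\Big(-\frac1L\nabla f(q_k)+f_{\mathrm{NP}}(q_k,p_k)\Big),\qquad q_{k+1}=q_k+T_{\mathrm{s}}\,p_{k+1},$$ maps $\partial\Gamma_k$ to $\partial\Gamma_{k+1}$ such that the signed areas satisfy $$A_{k+1}-A_k=-T_{\mathrm{s}}\int_{\partial\Gamma_k}f_{\mathrm{NP}}(q_k,p_k)\,\mathrm{d}q_k=-T_{\mathrm{s}}\int_{\Gamma_k}\Big(2d+\frac{\beta}{L}\Delta f(q_k+\beta p_k)\Big)\,\mathrm{d}q_k\wedge\mathrm{d}p_k.$$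
   Context: Standing assumptions (with $n=1$): $f:\mathbb{R}\to\mathbb{R}$ is differentiable, its derivative $\nabla f=f'$ is Lipschitz continuous with constant $L>0$, and $f$ is strongly convex with condition number $\kappa\ge1$, i.e. $f(x)\ge f(\bar x)+\nabla f(\bar x)(x-\bar x)+\frac{L}{2\kappa}|x-\bar x|^2$ for all $x,\bar x$; $f$ attains its minimum at $0$ and $f(0)=0$. $\Delta f=f''$ denotes the Hessian (existing almost everywhere). Constants: $d=\frac{1}{\sqrt\kappa+1}$, $\beta=\frac{\sqrt\kappa-1}{\sqrt\kappa+1}$. Non-potential forces: $f_{\mathrm{NP}}(q,p)=-2dp-\frac1L(\nabla f(q+\beta p)-\nabla f(q))$. Sign convention: the sign of the area is inferred from the orientation of the contour in the $(q,p)$-plane: for a counter-clockwise contour $\mathrm{d}q\wedge\mathrm{d}p=\mathrm{d}q\,\mathrm{d}p$ (the standard area measure), for a clockwise contour $\mathrm{d}q\wedge\mathrm{d}p=-\mathrm{d}q\,\mathrm{d}p$. Contours are oriented and piecewise continuously differentiable. The contour $\partial\Gamma_{k+1}=\psi(\partial\Gamma_k)$ carries the orientation induced by $\psi$, and $A_{k+1}$ is its signed area, that is, $A_{k+1}=\int_{\partial\Gamma_{k+1}}q_{k+1}\,\mathrm{d}p_{k+1}$ (equivalently the integral of the pullback of $\mathrm{d}q\wedge\mathrm{d}p$ under $\psi$ over $\Gamma_k$). *)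

theory Defs
  imports "HOL-Complex_Analysis.Complex_Analysis"
begin

text \<open>The phase plane is \<open>real \<times> real\<close>, with points \<open>(q, p)\<close>. For \<open>n = 1\<close> the gradient
  \<open>\<nabla>f\<close> is \<^term>\<open>deriv f\<close> and the Hessian \<open>\<Delta>f\<close> is \<^term>\<open>deriv (deriv f)\<close>. The latter exists
  only almost everywhere; its arbitrary values on the exceptional null set do not affect the
  integrals below, which are taken with respect to \<^term>\<open>lebesgue\<close>.\<close>

definition strongly_convex :: "(real \<Rightarrow> real) \<Rightarrow> real \<Rightarrow> real \<Rightarrow> bool" where
  "strongly_convex f L \<kappa> \<longleftrightarrow>
    (\<forall>x y. f x \<ge> f y + deriv f y * (x - y) + L / (2 * \<kappa>) * \<bar>x - y\<bar>\<^sup>2)"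

definition damp :: "real \<Rightarrow> real" where
  "damp \<kappa> = 1 / (sqrt \<kappa> + 1)"

definition mom :: "real \<Rightarrow> real" where
  "mom \<kappa> = (sqrt \<kappa> - 1) / (sqrt \<kappa> + 1)"

definition f_NP :: "(real \<Rightarrow> real) \<Rightarrow> real \<Rightarrow> real \<Rightarrow> real \<times> real \<Rightarrow> real" where
  "f_NP f L \<kappa> = (\<lambda>(q, p). - 2 * damp \<kappa> * p - 1 / L * (deriv f (q + mom \<kappa> * p) - deriv f q))"

definition psi :: "(real \<Rightarrow> real) \<Rightarrow> real \<Rightarrow> real \<Rightarrow> real \<Rightarrow> real \<times> real \<Rightarrow> real \<times> real" where
  "psi f L \<kappa> T = (\<lambda>(q, p).
    let p' = p + T * (- 1 / L * deriv f q + f_NP f L \<kappa> (q, p));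
        q' = q + T * p'
    in (q', p'))"

text \<open>Piecewise continuously differentiable in the classical sense: the derivative extends
  continuously to each closed piece, one-sidedly at the breakpoints. This is stronger than
  \<^const>\<open>valid_path\<close>, which allows the derivative to be unbounded near a breakpoint, so that
  line integrals along the path need not exist.\<close>

definition piecewise_C1_path :: "(real \<Rightarrow> real \<times> real) \<Rightarrow> bool" where
  "piecewise_C1_path \<gamma> \<longleftrightarrow>
    (\<exists>B. finite B \<and> {0, 1} \<subseteq> B \<and> B \<subseteq> {0..1} \<and>
      (\<forall>a\<in>B. \<forall>b\<in>B. a < b \<and> {a<..<b} \<inter> B = {} \<longrightarrow>
        (\<exists>D. continuous_on {a..b} D \<and>
          (\<forall>t\<in>{a..b}. (\<gamma> has_vector_derivative D t) (at t within {a..b})))))"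

definition simple_closed_contour :: "(real \<Rightarrow> real \<times> real) \<Rightarrow> bool" where
  "simple_closed_contour \<gamma> \<longleftrightarrow>
    simple_path \<gamma> \<and> pathfinish \<gamma> = pathstart \<gamma> \<and> piecewise_C1_path \<gamma>"

text \<open>Orientation is measured by the winding number after identifying \<open>(q, p)\<close> with \<open>q + i p\<close>.
  For a simple closed contour that is not counter-clockwise, the winding number about every
  enclosed point is \<open>-1\<close> (\<open>simple_closed_path_winding_number_inside\<close>).\<close>

definition counter_clockwise :: "(real \<Rightarrow> real \<times> real) \<Rightarrow> bool" where
  "counter_clockwise \<gamma> \<longleftrightarrow>
    (\<forall>(q, p) \<in> inside (path_image \<gamma>).
      winding_number (\<lambda>t. Complex (fst (\<gamma> t)) (snd (\<gamma> t))) (Complex q p) = 1)"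

definition area_form_integral :: "(real \<Rightarrow> real \<times> real) \<Rightarrow> (real \<times> real \<Rightarrow> real) \<Rightarrow> real" where
  "area_form_integral \<gamma> g =
    (if counter_clockwise \<gamma> then 1 else - 1) * (LINT z:inside (path_image \<gamma>)|lebesgue. g z)"

text \<open>Line integrals \<open>\<integral>\<^sub>\<gamma> g dq\<close> and \<open>\<integral>\<^sub>\<gamma> g dp\<close>. They are needed also for the image of a
  contour under \<^const>\<open>psi\<close>, which in general is only Lipschitz and thus has a derivative at
  almost every parameter only.\<close>

definition line_integral_dq :: "(real \<Rightarrow> real \<times> real) \<Rightarrow> (real \<times> real \<Rightarrow> real) \<Rightarrow> real" where
  "line_integral_dq \<gamma> g =
    (LINT t:{0..1}|lebesgue. g (\<gamma> t) * fst (vector_derivative \<gamma> (at t within {0..1})))"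

definition line_integral_dp :: "(real \<Rightarrow> real \<times> real) \<Rightarrow> (real \<times> real \<Rightarrow> real) \<Rightarrow> real" where
  "line_integral_dp \<gamma> g =
    (LINT t:{0..1}|lebesgue. g (\<gamma> t) * snd (vector_derivative \<gamma> (at t within {0..1})))"

text \<open>\<open>\<integral>\<^sub>\<Gamma> dq \<and> dp\<close> over the set enclosed by a simple closed contour.\<close>

definition enclosed_area :: "(real \<Rightarrow> real \<times> real) \<Rightarrow> real" where
  "enclosed_area \<gamma> = area_form_integral \<gamma> (\<lambda>_. 1)"

text \<open>\<open>\<integral> q dp\<close> along a closed contour. Unlike \<^const>\<open>enclosed_area\<close> this makes sense for
  contours that are not simple; \<^const>\<open>psi\<close> need not be injective, so the image of a simple
  contour need not be simple.\<close>

definition contour_area :: "(real \<Rightarrow> real \<times> real) \<Rightarrow> real" where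
  "contour_area \<gamma> = line_integral_dp \<gamma> fst"

end

theory Submission
  imports Defs "HOL-Real_Asymp.Real_Asymp"
begin

text \<open>
  Both equations come down to loop integrals \<open>\<integral> g(q + \<beta> p) dp\<close>. Write \<open>P = p\<^sub>k\<^sub>+\<^sub>1\<close> and
  \<open>Q = q\<^sub>k\<^sub>+\<^sub>1 = q + T P\<close> along the contour. Then \<open>Q dP - q dp + T f\<^sub>N\<^sub>P dq\<close> is the differential of
  \<open>q P + T P\<^sup>2 / 2 - q p + (T / L) f(q)\<close>: the step \<open>q + T P\<close> is a shear, the force \<open>-f'(q) / L\<close> has
  a potential, and only the non-potential force is left over. An exact differential integrates to
  \<open>0\<close> around a loop, which gives the change of \<open>\<integral> q dp\<close> (\<open>contour_area_psi\<close>). In the same way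
  \<open>f\<^sub>N\<^sub>P dq\<close> agrees up to an exact differential with \<open>2 d q dp + (\<beta> / L) f'(q + \<beta> p) dp\<close>
  (\<open>line_integral_f_NP\<close>). It remains to convert \<open>\<integral> q dp\<close> and \<open>\<integral> f'(q + \<beta> p) dp\<close> into integrals over
  the enclosed set.

  For this a form of Green's theorem is proved (\<open>green_lipschitz\<close>): if \<open>g\<close> is Lipschitz, then
  \<open>\<integral> g(q + \<beta> p) dp\<close> along the contour is the oriented integral of \<open>g'(q + \<beta> p)\<close> over the inside.
  Since the orientation is given by winding numbers, and nothing is known about the shape of the
  inside, the proof goes through the winding number itself. For \<open>\<beta> = 0\<close> and a loop \<open>(X, Y)\<close>,
  the winding number \<open>w(a, b)\<close> about \<open>(a, b)\<close> is \<open>1 / 2\<pi>\<close> times the integral of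
  \<open>((X - a) dY - (Y - b) dX) / ((X - a)\<^sup>2 + (Y - b)\<^sup>2)\<close>. Multiply by \<open>g'(a)\<close>, integrate over
  \<open>(a, b)\<close> in the box \<open>[-M, M] \<times> [-R, R]\<close>, and exchange the integrals. The integral over \<open>b\<close> of the
  first term is a difference of arctangents that tends to \<open>\<pi> sgn(X - a)\<close> as \<open>R\<close> tends to infinity;
  that of the second is half the logarithm of a ratio that tends to \<open>1\<close>. As
  \<open>\<integral> g'(a) sgn(X - a) da = 2 g(X) + const\<close>, exactly \<open>\<integral> g(X) dY\<close> survives
  (\<open>integral_winding_kernel\<close>). The integrability needed for Fubini's theorem is elementary, because
  the modulus of each term has an integral of at most \<open>\<pi>\<close> in one of the variables \<open>a\<close>, \<open>b\<close>.
  For general \<open>\<beta>\<close> the contour is sheared by \<open>(q, p) \<mapsto> (q + \<beta> p, p)\<close>, which changes neither area nor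
  winding numbers (\<open>lborel_shear\<close>, \<open>winding_number_shear\<close>).

  The functions \<open>f'\<close> and \<open>P\<close> are only Lipschitz, so all of this rests on the fact that a Lipschitz
  function is differentiable almost everywhere and is the integral of its derivative
  (\<open>lipschitz_derivative\<close>).
\<close>

section \<open>Lipschitz functions of one real variable\<close>

text \<open>The derivatives below are arbitrary on an exceptional null set and need not be Borel functions.
  Completeness of \<^term>\<open>lebesgue\<close> makes that harmless: they can be exchanged for Borel
  representatives under the integral.\<close>

lemma borel_measurable_lebesgue_AE_eq:
  fixes f h :: "'a::euclidean_space \<Rightarrow> real"
  assumes h: "h \<in> borel_measurable lebesgue" and eq: "AE x in lborel. f x = h x"
  shows "f \<in> borel_measurable lebesgue"
proof (rule borel_measurableI_le)
  fix a
  have *: "{x \<in> space lebesgue. h x \<le> a} \<in> sets lebesgue" using h by measurable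
  show "{x \<in> space lebesgue. f x \<le> a} \<in> sets lebesgue"
  proof (rule completion.in_sets_AE[OF _ *])
    show "AE x in lebesgue. (x \<in> {x \<in> space lebesgue. h x \<le> a}) = (x \<in> {x \<in> space lebesgue. f x \<le> a})"
      using AE_completion[OF eq] by (auto elim: eventually_mono)
  qed simp
qed

lemma integral_lebesgue_AE_cong:
  fixes f h :: "'a::euclidean_space \<Rightarrow> real"
  assumes h: "h \<in> borel_measurable lebesgue" and eq: "AE x in lborel. f x = h x"
  shows "integral\<^sup>L lebesgue f = integral\<^sup>L lebesgue h"
  using borel_measurable_lebesgue_AE_eq[OF assms] h AE_completion[OF eq]
  by (intro integral_cong_AE) auto

lemma integral_lebesgue_AE_eq:
  fixes f h :: "'a::euclidean_space \<Rightarrow> real"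
  assumes h: "h \<in> borel_measurable borel" and eq: "AE x in lborel. f x = h x"
  shows "integral\<^sup>L lebesgue f = integral\<^sup>L lborel h"
  using integral_lebesgue_AE_cong[OF _ eq] h integral_completion[of h lborel]
  by (simp add: measurable_completion)

text \<open>The image measure of Lebesgue measure under the inverse \<open>F\<^sup>-\<^sup>1\<close> assigns to \<open>A\<close> the measure of
  \<open>F(A)\<close>, hence \<open>F b - F a\<close> to an interval. As a Lipschitz map, \<open>F\<close> sends null sets to null sets, so
  the image measure is absolutely continuous and its Radon--Nikodym derivative is the density.
  The lower bound on the increments is there to make \<open>F\<close> a homeomorphism.\<close>

lemma strictly_increasing_density:
  fixes F :: "real \<Rightarrow> real"
  assumes low: "\<And>x y. x \<le> y \<Longrightarrow> y - x \<le> F y - F x"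
    and lip: "K-lipschitz_on UNIV F"
  obtains k where "k \<in> borel_measurable borel"
    "\<And>a b. a \<le> b \<Longrightarrow> (k has_integral (F b - F a)) {a..b}"
proof -
  have smono: "strict_mono F"
  proof (rule strict_monoI)
    fix x y :: real assume "x < y"
    then show "F x < F y" using low[of x y] by simp
  qed
  have contF: "continuous_on A F" for A
    using lip lipschitz_on_continuous_on continuous_on_subset by blast
  have surjF: "surj F"
  proof -
    have "\<exists>x. F x = y" for y
    proof -
      define d where "d = \<bar>y - F 0\<bar>"
      have "F (- d) \<le> y" using low[of "-d" 0] by (auto simp: d_def)
      moreover have "y \<le> F d" using low[of 0 d] by (auto simp: d_def)
      ultimately show ?thesis
        using IVT'[of F "-d" y d] contF by (auto simp: d_def)
    qed
    then show ?thesis by (metis surjI)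
  qed
  have bijF: "bij F" using smono surjF strict_mono_imp_inj_on bij_betw_def by blast
  define G where "G = inv F"
  have FG: "F (G y) = y" and GF: "G (F x) = x" for x y
    using bijF by (auto simp: G_def bij_is_surj surj_f_inv_f bij_is_inj)
  have "1-lipschitz_on UNIV G"
  proof (rule lipschitz_onI)
    fix x y
    show "dist (G x) (G y) \<le> 1 * dist x y"
      using low[of "G x" "G y"] low[of "G y" "G x"] by (auto simp: FG dist_real_def abs_if)
  qed simp
  then have contG: "continuous_on UNIV G" by (rule lipschitz_on_continuous_on)
  then have measG [measurable]: "G \<in> borel_measurable borel"
    by (rule borel_measurable_continuous_onI)
  have vim: "G -` A = F ` A" for A
  proof (intro equalityI subsetI)
    fix y assume "y \<in> G -` A"
    then show "y \<in> F ` A" using FG[of y] by (intro image_eqI[of y F "G y"]) auto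
  qed (auto simp: GF)
  define M where "M = distr lborel borel G"
  have emM: "emeasure M A = emeasure lborel (F ` A)" if "A \<in> sets borel" for A
    using that by (simp add: M_def emeasure_distr vim)
  have ac: "absolutely_continuous lborel M"
    unfolding absolutely_continuous_def
  proof
    fix A :: "real set" assume A: "A \<in> null_sets lborel"
    then have Ab: "A \<in> sets borel" by auto
    have "negligible A" using A by (simp add: negligible_iff_null_sets null_sets_completionI)
    then have "negligible (F ` A)"
      by (rule negligible_locally_Lipschitz_image[rotated])
        (use lipschitz_onD[OF lip] in \<open>auto intro!: exI[of _ UNIV] exI[of _ K] simp: dist_norm\<close>)
    then have "emeasure lebesgue (F ` A) = 0" by (simp add: negligible_iff_null_sets null_sets_def)
    moreover have "F ` A \<in> sets borel"
      using measurable_sets[OF measG Ab] by (simp add: vim)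
    ultimately have "emeasure M A = 0" using emM[OF Ab] by simp
    then show "A \<in> null_sets M" using Ab by (simp add: null_sets_def M_def)
  qed
  define r where "r = RN_deriv lborel M"
  have [measurable]: "r \<in> borel_measurable borel" by (simp add: r_def)
  have dens: "density lborel r = M"
    unfolding r_def by (rule sigma_finite_measure.density_RN_deriv[OF sigma_finite_lborel ac]) (simp add: M_def)
  have int_r: "(\<integral>\<^sup>+x. r x * indicator {a..b} x \<partial>lborel) = ennreal (F b - F a)" if "a \<le> b" for a b
  proof -
    have "(\<integral>\<^sup>+x. r x * indicator {a..b} x \<partial>lborel) = emeasure (density lborel r) {a..b}"
      by (simp add: emeasure_density)
    also have "\<dots> = emeasure lborel (F ` {a..b})" unfolding dens by (rule emM) simp
    also have "F ` {a..b} = {F a..F b}"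
    proof (intro equalityI subsetI)
      fix y assume y: "y \<in> {F a..F b}"
      have "a \<le> G y \<and> G y \<le> b"
        using y strict_mono_less_eq[OF smono, of a "G y"] strict_mono_less_eq[OF smono, of "G y" b]
        by (simp add: FG)
      then show "y \<in> F ` {a..b}" by (intro image_eqI[of y F "G y"]) (auto simp: FG)
    qed (auto simp: strict_mono_less_eq[OF smono])
    finally show ?thesis using strict_mono_less_eq[OF smono] that by simp
  qed
  have fin: "AE x in lborel. r x \<noteq> \<infinity>"
  proof -
    have "AE x in lborel. r x * indicator {- real n..real n} x \<noteq> \<infinity>" for n
      by (rule nn_integral_PInf_AE) (use int_r[of "- real n" "real n"] in auto)
    then have "AE x in lborel. \<forall>n. r x * indicator {- real n..real n} x \<noteq> \<infinity>"
      by (simp add: AE_all_countable)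
    then show ?thesis
    proof eventually_elim
      case (elim x)
      obtain n where "\<bar>x\<bar> \<le> real n" using real_arch_simple by blast
      then show ?case using elim[rule_format, of n] by (auto simp: abs_le_iff)
    qed
  qed
  define k where "k = (\<lambda>x. enn2real (r x))"
  have [measurable]: "k \<in> borel_measurable borel" by (simp add: k_def)
  have "(k has_integral (F b - F a)) {a..b}" if "a \<le> b" for a b
  proof -
    have "(\<integral>\<^sup>+x. ennreal (k x * indicator {a..b} x) \<partial>lborel) = (\<integral>\<^sup>+x. r x * indicator {a..b} x \<partial>lborel)"
      by (rule nn_integral_cong_AE, use fin in eventually_elim)
        (auto simp: k_def indicator_def ennreal_enn2real less_top)
    also have "\<dots> = ennreal (F b - F a)" by (rule int_r[OF that])
    finally have "((\<lambda>x. k x * indicator {a..b} x) has_integral (F b - F a)) UNIV"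
      using strict_mono_less_eq[OF smono] that
      by (intro nn_integral_has_integral) (auto simp: k_def)
    then have "((\<lambda>x. if x \<in> {a..b} then k x else 0) has_integral (F b - F a)) UNIV"
      by (rule has_integral_eq[rotated]) auto
    then show ?thesis by (simp only: has_integral_restrict_UNIV)
  qed
  then show ?thesis using that \<open>k \<in> borel_measurable borel\<close> by blast
qed

text \<open>Lebesgue's differentiation theorem in the form \<open>integrable_ccontinuous_explicit\<close> averages over
  cubes with lowest corner at the given point, so that it yields right derivatives only; left
  derivatives come from the reflected integrand.\<close>

lemma AE_has_real_derivative_indefinite_integral:
  fixes F k :: "real \<Rightarrow> real"
  assumes k: "\<And>a b. a \<le> b \<Longrightarrow> (k has_integral (F b - F a)) {a..b}"
  shows "AE x in lebesgue. (F has_real_derivative k x) (at x)"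
proof -
  have "k integrable_on cbox a b" for a b
    using k[of a b] by (cases "a \<le> b") (auto simp: integrable_on_def)
  then obtain N where N: "negligible N"
    "\<And>x e. \<lbrakk>x \<notin> N; 0 < e\<rbrakk> \<Longrightarrow> \<exists>d>0. \<forall>h. 0 < h \<and> h < d \<longrightarrow>
       norm (integral (cbox x (x + h *\<^sub>R One)) k /\<^sub>R h ^ DIM(real) - k x) < e"
    using integrable_ccontinuous_explicit[of k] by metis
  define k' where "k' = (\<lambda>x. k (- x))"
  have k': "(k' has_integral (F (-a) - F (-b))) {a..b}" if "a \<le> b" for a b
    using k[of "-b" "-a"] that unfolding k'_def
    by (subst has_integral_reflect_real[symmetric]) auto
  have "k' integrable_on cbox a b" for a b
    using k'[of a b] by (cases "a \<le> b") (auto simp: integrable_on_def)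
  then obtain N' where N': "negligible N'"
    "\<And>x e. \<lbrakk>x \<notin> N'; 0 < e\<rbrakk> \<Longrightarrow> \<exists>d>0. \<forall>h. 0 < h \<and> h < d \<longrightarrow>
       norm (integral (cbox x (x + h *\<^sub>R One)) k' /\<^sub>R h ^ DIM(real) - k' x) < e"
    using integrable_ccontinuous_explicit[of k'] by metis
  have "negligible (uminus ` N')"
    using N'(1) by (intro negligible_differentiable_image_negligible)
      (auto intro!: derivative_intros simp: differentiable_on_def)
  then have "negligible (N \<union> uminus ` N')" using N(1) by (rule negligible_Un[rotated])
  moreover have "(F has_real_derivative k x) (at x)" if x: "x \<notin> N \<union> uminus ` N'" for x
  proof -
    have xN: "x \<notin> N" "- x \<notin> N'" using x by (auto simp: image_iff)
    have "\<exists>d>0. \<forall>h. h \<noteq> 0 \<and> norm (h - 0) < d \<longrightarrow> norm ((F (x + h) - F x) / h - k x) < e" if epos: "e > 0" for e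
    proof -
      obtain d1 where d1: "d1 > 0" "\<And>h. 0 < h \<Longrightarrow> h < d1 \<Longrightarrow>
         norm (integral {x..x + h} k / h - k x) < e"
        using N(2)[OF xN(1) epos] by (auto simp: divide_inverse mult.commute)
      obtain d2 where d2: "d2 > 0" "\<And>h. 0 < h \<Longrightarrow> h < d2 \<Longrightarrow>
         norm (integral {-x..-x + h} k' / h - k' (-x)) < e"
        using N'(2)[OF xN(2) epos] by (auto simp: divide_inverse mult.commute)
      have "norm ((F (x + h) - F x) / h - k x) < e" if h: "h \<noteq> 0" "\<bar>h\<bar> < min d1 d2" for h
      proof (cases "h > 0")
        case True
        then show ?thesis using d1(2)[of h] h k[of x "x + h"] by (auto simp: integral_unique)
      next
        case False
        then have "integral {-x..-x + (-h)} k' = F x - F (x + h)"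
          using h k'[of "-x" "-x + (-h)"] by (auto simp: integral_unique add.commute)
        then show ?thesis using d2(2)[of "-h"] h False
          by (auto simp: k'_def divide_simps split: if_splits)
      qed
      then show ?thesis using d1(1) d2(1) by (intro exI[of _ "min d1 d2"]) auto
    qed
    then show ?thesis unfolding DERIV_def LIM_eq by blast
  qed
  ultimately show ?thesis
    by (intro AE_I'[of "N \<union> uminus ` N'"]) (auto simp: negligible_iff_null_sets)
qed

text \<open>Adding \<open>(C + 1) x\<close> to a \<open>C\<close>-Lipschitz function makes its increments at least those of the
  identity, so that it has a density.\<close>

lemma lipschitz_derivative:
  fixes g :: "real \<Rightarrow> real"
  assumes C: "C-lipschitz_on UNIV g"
  obtains h where "h \<in> borel_measurable borel" "\<And>x. \<bar>h x\<bar> \<le> C"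
    "AE x in lborel. (g has_real_derivative h x) (at x)"
    "\<And>a b. a \<le> b \<Longrightarrow> (h has_integral (g b - g a)) {a..b}"
proof -
  have C0: "C \<ge> 0" using C by (rule lipschitz_on_nonneg)
  have lipg: "\<bar>g x - g y\<bar> \<le> C * \<bar>x - y\<bar>" for x y
    using lipschitz_onD[OF C, of x y] by (simp add: dist_real_def)
  define F where "F = (\<lambda>x. g x + (C + 1) * x)"
  have low: "y - x \<le> F y - F x" if "x \<le> y" for x y
    using lipg[of x y] that by (auto simp: F_def algebra_simps)
  have lipF: "(2 * C + 1)-lipschitz_on UNIV F"
  proof (rule lipschitz_onI)
    fix x y
    have "\<bar>F x - F y\<bar> \<le> \<bar>g x - g y\<bar> + \<bar>(C + 1) * (x - y)\<bar>"
      by (simp add: F_def algebra_simps)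
    also have "\<dots> \<le> C * \<bar>x - y\<bar> + (C + 1) * \<bar>x - y\<bar>"
      using lipg[of x y] C0 by (simp add: abs_mult)
    finally show "dist (F x) (F y) \<le> (2 * C + 1) * dist x y"
      by (simp add: dist_real_def algebra_simps)
  qed (use C0 in simp)
  obtain k where k: "k \<in> borel_measurable borel"
    "\<And>a b. a \<le> b \<Longrightarrow> (k has_integral (F b - F a)) {a..b}"
    by (rule strictly_increasing_density[OF low lipF]) (assumption | blast)+
  \<comment> \<open>Clamping makes \<open>h\<close> bounded everywhere and has no effect where \<open>k x\<close> is the derivative of \<open>F\<close>.\<close>
  define h where "h = (\<lambda>x. max (- C) (min C (k x - (C + 1))))"
  have hm: "h \<in> borel_measurable borel" using k(1) by (simp add: h_def)
  have "AE x in lebesgue. (F has_real_derivative k x) (at x)"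
    by (rule AE_has_real_derivative_indefinite_integral) (rule k(2))
  then have der: "AE x in lebesgue. (g has_real_derivative h x) (at x) \<and> h x = k x - (C + 1)"
  proof eventually_elim
    case (elim x)
    have "((\<lambda>x. F x - (C + 1) * x) has_real_derivative (k x - (C + 1))) (at x)"
      by (rule derivative_eq_intros elim refl)+ simp
    then have d: "(g has_real_derivative (k x - (C + 1))) (at x)"
      by (simp add: F_def)
    then have lim: "((\<lambda>y. (g y - g x) / (y - x)) \<longlongrightarrow> k x - (C + 1)) (at x)"
      by (simp add: has_field_derivative_iff)
    have b: "\<bar>(g y - g x) / (y - x)\<bar> \<le> C" for y
      using lipg[of y x] C0 by (cases "y = x") (auto simp: abs_divide divide_le_eq)
    have b': "(g y - g x) / (y - x) \<le> C" "- C \<le> (g y - g x) / (y - x)" for y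
      using b[of y] unfolding abs_le_iff by linarith+
    have "k x - (C + 1) \<le> C"
      by (rule tendsto_upperbound[OF lim]) (use b' in \<open>auto intro!: always_eventually\<close>)
    moreover have "- C \<le> k x - (C + 1)"
      by (rule tendsto_lowerbound[OF lim]) (use b' in \<open>auto intro!: always_eventually\<close>)
    ultimately have "h x = k x - (C + 1)" by (simp add: h_def)
    then show ?case using d by simp
  qed
  then have der1: "AE x in lborel. (g has_real_derivative h x) (at x)"
    by (simp add: AE_completion_iff)
  have "(h has_integral (g b - g a)) {a..b}" if "a \<le> b" for a b
  proof -
    obtain N where N: "N \<in> null_sets lebesgue"
      "\<And>x. x \<in> space lebesgue - N \<Longrightarrow> (g has_real_derivative h x) (at x) \<and> h x = k x - (C + 1)"
      by (rule AE_E3[OF der]) (rule that; assumption)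
    have "((\<lambda>x. k x - (C + 1)) has_integral (F b - F a - (C + 1) * (b - a))) {a..b}"
      using has_integral_diff[OF k(2)[OF that] has_integral_const_real[where c="C + 1" and a=a and b=b]] that
      by (simp add: mult.commute)
    then have "(h has_integral (F b - F a - (C + 1) * (b - a))) {a..b}"
      by (rule has_integral_spike[rotated 2]) (use N in \<open>auto simp: negligible_iff_null_sets\<close>)
    then show ?thesis by (simp add: F_def algebra_simps)
  qed
  moreover have "\<bar>h x\<bar> \<le> C" for x using C0 by (auto simp: h_def)
  ultimately show ?thesis using that[OF hm _ der1] by simp
qed


lemma clamp_lipschitz:
  fixes u :: "real \<Rightarrow> 'a::metric_space"
  assumes "C-lipschitz_on {a..b} u" "a \<le> b"
  shows "C-lipschitz_on UNIV (\<lambda>t. u (max a (min b t)))"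
proof (rule lipschitz_onI)
  fix x y :: real
  have "dist (u (max a (min b x))) (u (max a (min b y)))
      \<le> C * dist (max a (min b x)) (max a (min b y))"
    using assms by (intro lipschitz_onD) auto
  also have "\<dots> \<le> C * dist x y"
    using lipschitz_on_nonneg[OF assms(1)] by (intro mult_left_mono) (auto simp: dist_real_def)
  finally show "dist (u (max a (min b x))) (u (max a (min b y))) \<le> C * dist x y" .
qed (rule lipschitz_on_nonneg[OF assms(1)])

lemma AE_lborel_neq: "AE x in lborel. x \<noteq> (a::'a::euclidean_space)"
  by (rule AE_I'[of "{a}"]) auto

text \<open>A function on an interval is extended by clamping the argument; this changes the derivative
  at most at the two endpoints, which the almost-everywhere statement excludes explicitly.\<close>

lemma lipschitz_interval_derivative:
  fixes u :: "real \<Rightarrow> real"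
  assumes u: "C-lipschitz_on {a..b} u" and ab: "a \<le> b"
  obtains h where "h \<in> borel_measurable borel" "\<And>x. \<bar>h x\<bar> \<le> C"
    "AE t in lborel. t \<in> {a..b} \<longrightarrow> a < t \<and> t < b \<and> (u has_real_derivative h t) (at t)"
    "(h has_integral (u b - u a)) {a..b}"
proof -
  define U where "U = (\<lambda>t. u (max a (min b t)))"
  obtain h where h: "h \<in> borel_measurable borel" "\<And>x. \<bar>h x\<bar> \<le> C"
    "AE x in lborel. (U has_real_derivative h x) (at x)"
    "\<And>a b. a \<le> b \<Longrightarrow> (h has_integral (U b - U a)) {a..b}"
    by (rule lipschitz_derivative[OF clamp_lipschitz[OF assms, folded U_def]]) blast
  have "AE t in lborel. t \<in> {a..b} \<longrightarrow> a < t \<and> t < b \<and> (u has_real_derivative h t) (at t)"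
    using h(3) AE_lborel_neq[of a] AE_lborel_neq[of b]
  proof eventually_elim
    case (elim t)
    have "(u has_real_derivative h t) (at t)" if t: "a < t" "t < b"
      by (rule has_field_derivative_transform_within_open[OF elim(1), of "{a<..<b}"])
        (use t in \<open>auto simp: U_def\<close>)
    then show ?case using elim by auto
  qed
  moreover have "(h has_integral (u b - u a)) {a..b}"
    using h(4)[OF ab] ab by (simp add: U_def)
  ultimately show ?thesis using that h(1,2) by blast
qed

lemma set_integrable_bounded_interval:
  fixes f :: "real \<Rightarrow> real"
  assumes "f \<in> borel_measurable borel" "\<And>x. x \<in> {a..b} \<Longrightarrow> \<bar>f x\<bar> \<le> C"
  shows "set_integrable lborel {a..b} f"
  unfolding set_integrable_def
  by (rule integrableI_bounded_set_indicator[where B=C]) (use assms in \<open>auto simp: emeasure_lborel_Icc_eq less_top[symmetric]\<close>)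

text \<open>The fundamental theorem of calculus for Lipschitz functions, for any representative of the
  derivative.\<close>

lemma lipschitz_integral_derivative:
  fixes u u' :: "real \<Rightarrow> real"
  assumes u: "C-lipschitz_on {a..b} u" and ab: "a \<le> b"
    and u': "AE t in lborel. t \<in> {a..b} \<longrightarrow> (u has_real_derivative u' t) (at t)"
  shows "(LINT t:{a..b}|lebesgue. u' t) = u b - u a"
proof -
  obtain h where h: "h \<in> borel_measurable borel" "\<And>x. \<bar>h x\<bar> \<le> C"
    "AE t in lborel. t \<in> {a..b} \<longrightarrow> a < t \<and> t < b \<and> (u has_real_derivative h t) (at t)"
    "(h has_integral (u b - u a)) {a..b}"
    using lipschitz_interval_derivative[OF u ab] by blast
  have [measurable]: "h \<in> borel_measurable borel" by (rule h)
  have "(LINT t:{a..b}|lebesgue. u' t) = (LINT t:{a..b}|lborel. h t)"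
    unfolding set_lebesgue_integral_def
  proof (rule integral_lebesgue_AE_eq)
    show "AE x in lborel. indicat_real {a..b} x *\<^sub>R u' x = indicat_real {a..b} x *\<^sub>R h x"
      using h(3) u' by eventually_elim (auto intro: DERIV_unique simp: indicator_def)
  qed measurable
  also have "\<dots> = integral {a..b} h"
    by (intro set_borel_integral_eq_integral set_integrable_bounded_interval[of _ _ _ C] h)
  also have "\<dots> = u b - u a" using h(4) by (rule integral_unique)
  finally show ?thesis .
qed

section \<open>Integrals of the winding kernel over a box\<close>

lemma has_bochner_integral_arctan_kernel:
  fixes c y R :: real
  assumes "R \<ge> 0"
  shows "has_bochner_integral lborel (\<lambda>b. c / (c\<^sup>2 + (y - b)\<^sup>2) * indicator {-R..R} b)
    (arctan ((y + R) / c) - arctan ((y - R) / c))"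
proof (cases "c = 0")
  case False
  have pos: "c\<^sup>2 + (y - b)\<^sup>2 > 0" for b using False by (simp add: add_pos_nonneg)
  have "has_bochner_integral lborel (\<lambda>b. c / (c\<^sup>2 + (y - b)\<^sup>2) * indicator {-R..R} b)
    (- arctan ((y - R) / c) - (- arctan ((y - (- R)) / c)))"
  proof (rule has_bochner_integral_FTC_Icc_real)
    fix b
    show "((\<lambda>b. - arctan ((y - b) / c)) has_real_derivative c / (c\<^sup>2 + (y - b)\<^sup>2)) (at b)"
      using False pos[of b] by (auto intro!: derivative_eq_intros simp: field_simps power2_eq_square)
    show "isCont (\<lambda>b. c / (c\<^sup>2 + (y - b)\<^sup>2)) b"
      using pos[of b] by (auto intro!: continuous_intros)
  qed (use assms in simp)
  then show ?thesis by simp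
qed (simp add: has_bochner_integral_zero)

lemma has_bochner_integral_ln_kernel:
  fixes c y R :: real
  assumes "R \<ge> 0" "c \<noteq> 0"
  shows "has_bochner_integral lborel (\<lambda>b. (y - b) / (c\<^sup>2 + (y - b)\<^sup>2) * indicator {-R..R} b)
    ((ln (c\<^sup>2 + (y + R)\<^sup>2) - ln (c\<^sup>2 + (y - R)\<^sup>2)) / 2)"
proof -
  have pos: "c\<^sup>2 + (y - b)\<^sup>2 > 0" for b using assms(2) by (simp add: add_pos_nonneg)
  have "has_bochner_integral lborel (\<lambda>b. (y - b) / (c\<^sup>2 + (y - b)\<^sup>2) * indicator {-R..R} b)
    (- ln (c\<^sup>2 + (y - R)\<^sup>2) / 2 - (- ln (c\<^sup>2 + (y - (- R))\<^sup>2) / 2))"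
  proof (rule has_bochner_integral_FTC_Icc_real)
    fix b
    have "((\<lambda>b. c\<^sup>2 + (y - b)\<^sup>2) has_real_derivative 2 * (y - b) * - 1) (at b)"
      by (auto intro!: derivative_eq_intros)
    from DERIV_chain2[OF DERIV_ln[OF pos] this]
    have ln: "((\<lambda>b. ln (c\<^sup>2 + (y - b)\<^sup>2)) has_real_derivative
        inverse (c\<^sup>2 + (y - b)\<^sup>2) * (2 * (y - b) * - 1)) (at b)" .
    have "- (i * (2 * w * - 1)) / 2 = w * i" for i w :: real by simp
    then have eq: "- (inverse d * (2 * (y - b) * - 1)) / 2 = (y - b) / d" for d
      unfolding divide_inverse[of "y - b"] .
    show "((\<lambda>b. - ln (c\<^sup>2 + (y - b)\<^sup>2) / 2) has_real_derivative (y - b) / (c\<^sup>2 + (y - b)\<^sup>2)) (at b)"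
      by (rule DERIV_cong[OF DERIV_cdivide[OF DERIV_minus[OF ln], of 2] eq])
    show "isCont (\<lambda>b. (y - b) / (c\<^sup>2 + (y - b)\<^sup>2)) b"
      using pos[of b] by (auto intro!: continuous_intros)
  qed (use assms in simp)
  then show ?thesis by (simp add: field_simps)
qed

lemma nn_integral_arctan_kernel_le:
  fixes c y R :: real
  shows "(\<integral>\<^sup>+b. ennreal (\<bar>c\<bar> / (c\<^sup>2 + (y - b)\<^sup>2) * indicator {-R..R} b) \<partial>lborel) \<le> ennreal pi"
proof (cases "R \<ge> 0")
  case True
  have "has_bochner_integral lborel (\<lambda>b. \<bar>c\<bar> / (c\<^sup>2 + (y - b)\<^sup>2) * indicator {-R..R} b)
    (arctan ((y + R) / \<bar>c\<bar>) - arctan ((y - R) / \<bar>c\<bar>))"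
    using has_bochner_integral_arctan_kernel[OF True, of "\<bar>c\<bar>" y] by simp
  then have "(\<integral>\<^sup>+b. ennreal (\<bar>c\<bar> / (c\<^sup>2 + (y - b)\<^sup>2) * indicator {-R..R} b) \<partial>lborel)
      = ennreal (arctan ((y + R) / \<bar>c\<bar>) - arctan ((y - R) / \<bar>c\<bar>))"
    by (subst nn_integral_eq_integral) (auto simp: has_bochner_integral_iff)
  also have "\<dots> \<le> ennreal pi"
    using arctan_ubound[of "(y + R) / \<bar>c\<bar>"] arctan_lbound[of "(y - R) / \<bar>c\<bar>"]
    by (intro ennreal_leI) linarith
  finally show ?thesis .
qed simp

text \<open>The singularity of order \<open>1 / r\<close> at \<open>(x, y)\<close> is integrable. To see it, each component of the
  kernel is integrated first in the variable in which it is a Poisson kernel, with total mass at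
  most \<open>\<pi>\<close>: the first one in \<open>b\<close>, the second one in \<open>a\<close>.\<close>

lemma nn_integral_planar_kernel_le:
  fixes x y M R :: real
  assumes "M \<ge> 0" "R \<ge> 0"
  shows "(\<integral>\<^sup>+z. ennreal (\<bar>x - fst z\<bar> / ((x - fst z)\<^sup>2 + (y - snd z)\<^sup>2) * indicator ({-M..M} \<times> {-R..R}) z)
            \<partial>lborel) \<le> ennreal (2 * M * pi)" (is ?fst)
    and "(\<integral>\<^sup>+z. ennreal (\<bar>y - snd z\<bar> / ((x - fst z)\<^sup>2 + (y - snd z)\<^sup>2) * indicator ({-M..M} \<times> {-R..R}) z)
            \<partial>lborel) \<le> ennreal (2 * R * pi)" (is ?snd)
proof -
  have "(\<integral>\<^sup>+z. ennreal (\<bar>x - fst z\<bar> / ((x - fst z)\<^sup>2 + (y - snd z)\<^sup>2) * indicator ({-M..M} \<times> {-R..R}) z) \<partial>lborel)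
    = (\<integral>\<^sup>+a. \<integral>\<^sup>+b. ennreal (\<bar>x - a\<bar> / ((x - a)\<^sup>2 + (y - b)\<^sup>2) * indicator ({-M..M} \<times> {-R..R}) (a, b)) \<partial>lborel \<partial>lborel)"
    unfolding lborel_prod[symmetric] by (subst lborel.nn_integral_fst[symmetric]) (auto, measurable)
  also have "\<dots> \<le> (\<integral>\<^sup>+a. ennreal pi * indicator {-M..M} a \<partial>lborel)"
  proof (rule nn_integral_mono)
    fix a
    show "(\<integral>\<^sup>+b. ennreal (\<bar>x - a\<bar> / ((x - a)\<^sup>2 + (y - b)\<^sup>2) * indicator ({-M..M} \<times> {-R..R}) (a, b)) \<partial>lborel)
      \<le> ennreal pi * indicator {-M..M} a"
      using nn_integral_arctan_kernel_le[of "x - a" y R]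
      by (cases "a \<in> {-M..M}") (auto simp: indicator_times)
  qed
  also have "\<dots> = ennreal (2 * M * pi)"
    using assms by (simp add: nn_integral_cmult_indicator ennreal_mult[symmetric] mult.commute)
  finally show ?fst .
  have "(\<integral>\<^sup>+z. ennreal (\<bar>y - snd z\<bar> / ((x - fst z)\<^sup>2 + (y - snd z)\<^sup>2) * indicator ({-M..M} \<times> {-R..R}) z) \<partial>lborel)
    = (\<integral>\<^sup>+b. \<integral>\<^sup>+a. ennreal (\<bar>y - b\<bar> / ((x - a)\<^sup>2 + (y - b)\<^sup>2) * indicator ({-M..M} \<times> {-R..R}) (a, b)) \<partial>lborel \<partial>lborel)"
    unfolding lborel_prod[symmetric] by (subst lborel_pair.nn_integral_snd[symmetric]) (auto, measurable)
  also have "\<dots> \<le> (\<integral>\<^sup>+b. ennreal pi * indicator {-R..R} b \<partial>lborel)"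
  proof (rule nn_integral_mono)
    fix b
    show "(\<integral>\<^sup>+a. ennreal (\<bar>y - b\<bar> / ((x - a)\<^sup>2 + (y - b)\<^sup>2) * indicator ({-M..M} \<times> {-R..R}) (a, b)) \<partial>lborel)
      \<le> ennreal pi * indicator {-R..R} b"
      using nn_integral_arctan_kernel_le[of "y - b" x M]
      by (cases "b \<in> {-R..R}") (auto simp: indicator_times add.commute)
  qed
  also have "\<dots> = ennreal (2 * R * pi)"
    using assms by (simp add: nn_integral_cmult_indicator ennreal_mult[symmetric] mult.commute)
  finally show ?snd .
qed

text \<open>Since \<open>R \<ge> 2 M\<close>, the distances from \<open>y\<close> to \<open>R\<close> and to \<open>- R\<close> differ at most by the factor \<open>3\<close>, so
  the ratio of the arguments of the two logarithms is at most \<open>9\<close>.\<close>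

lemma abs_ln_kernel_le:
  fixes c y R M :: real
  assumes "c \<noteq> 0" "\<bar>y\<bar> \<le> M" "2 * M \<le> R" "0 < R"
  shows "\<bar>(ln (c\<^sup>2 + (y + R)\<^sup>2) - ln (c\<^sup>2 + (y - R)\<^sup>2)) / 2\<bar> \<le> 4"
proof -
  have gen: "ln (c\<^sup>2 + u\<^sup>2) - ln (c\<^sup>2 + v\<^sup>2) \<le> 8" if uv: "\<bar>u\<bar> \<le> 3 * \<bar>v\<bar>" for u v :: real
  proof -
    have p: "c\<^sup>2 + u\<^sup>2 > 0" "c\<^sup>2 + v\<^sup>2 > 0" using assms(1) by (auto simp: add_pos_nonneg)
    have "\<bar>u\<bar> \<le> \<bar>3 * v\<bar>" using uv by (simp add: abs_mult)
    then have "u\<^sup>2 \<le> (3 * v)\<^sup>2" by (simp only: abs_le_square_iff)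
    then have "u\<^sup>2 \<le> 9 * v\<^sup>2" by (simp add: power_mult_distrib)
    then have "c\<^sup>2 + u\<^sup>2 \<le> 9 * (c\<^sup>2 + v\<^sup>2)"
      using zero_le_power2[of c] by argo
    then have "ln (c\<^sup>2 + u\<^sup>2) \<le> ln (9 * (c\<^sup>2 + v\<^sup>2))" using p by (subst ln_le_cancel_iff) auto
    also have "\<dots> = ln 9 + ln (c\<^sup>2 + v\<^sup>2)" using p by (subst ln_mult) auto
    also have "ln (9::real) \<le> 8" using ln_le_minus_one[of "9::real"] by simp
    finally show ?thesis by simp
  qed
  have "\<bar>y + R\<bar> \<le> 3 * \<bar>y - R\<bar>" "\<bar>y - R\<bar> \<le> 3 * \<bar>y + R\<bar>" using assms by (auto simp: abs_if split: if_splits)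
  then show ?thesis using gen[of "y + R" "y - R"] gen[of "y - R" "y + R"] by (auto simp: abs_le_iff)
qed

lemma tendsto_ln_kernel:
  fixes c y N :: real
  assumes "c \<noteq> 0"
  shows "(\<lambda>n. (ln (c\<^sup>2 + (y + (N + real n))\<^sup>2) - ln (c\<^sup>2 + (y - (N + real n))\<^sup>2)) / 2) \<longlonglongrightarrow> 0"
proof -
  have "((\<lambda>r. (ln (c\<^sup>2 + (y + (N + r))\<^sup>2) - ln (c\<^sup>2 + (y - (N + r))\<^sup>2)) / 2) \<longlongrightarrow> 0) at_top"
    using assms by real_asymp
  then show ?thesis by (rule filterlim_compose[OF _ filterlim_real_sequentially])
qed

lemma tendsto_arctan_kernel:
  fixes c y N :: real
  shows "(\<lambda>n. arctan ((y + (N + real n)) / c) - arctan ((y - (N + real n)) / c)) \<longlonglongrightarrow> pi * sgn c"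
proof -
  consider "c = 0" | "c > 0" | "c < 0" by linarith
  then have "((\<lambda>r. arctan ((y + (N + r)) / c) - arctan ((y - (N + r)) / c)) \<longlongrightarrow> pi * sgn c) at_top"
  proof cases
    case 1 then show ?thesis by simp
  next
    case 2 
    have "((\<lambda>r. arctan ((y + (N + r)) / c) - arctan ((y - (N + r)) / c)) \<longlongrightarrow> pi) at_top"
      using 2 by real_asymp
    then show ?thesis using 2 by simp
  next
    case 3
    have "((\<lambda>r. arctan ((y + (N + r)) / c) - arctan ((y - (N + r)) / c)) \<longlongrightarrow> - pi) at_top"
      using 3 by real_asymp
    then show ?thesis using 3 by simp
  qed
  then show ?thesis by (rule filterlim_compose[OF _ filterlim_real_sequentially])
qed

lemma fst_snd_borel_measurable [measurable]:
  "fst \<in> borel_measurable (borel :: (real \<times> real) measure)"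
  "snd \<in> borel_measurable (borel :: (real \<times> real) measure)"
  by (intro borel_measurable_continuous_onI continuous_intros)+

lemma planar_kernel_bounded_factor:
  fixes f :: "real \<times> real \<Rightarrow> real" and h :: "real \<Rightarrow> real"
  assumes [measurable]: "f \<in> borel_measurable borel" "h \<in> borel_measurable borel"
    and h: "\<And>a. \<bar>h a\<bar> \<le> C"
    and f: "(\<integral>\<^sup>+z. ennreal \<bar>f z\<bar> \<partial>lborel) \<le> ennreal B"
  shows "(\<integral>\<^sup>+z. ennreal \<bar>h (fst z) * f z\<bar> \<partial>lborel) \<le> ennreal (C * B)"
    and "integrable lborel (\<lambda>z. h (fst z) * f z)"
proof -
  have C: "C \<ge> 0" using h[of 0] by simp
  have "(\<integral>\<^sup>+z. ennreal \<bar>h (fst z) * f z\<bar> \<partial>lborel) \<le> (\<integral>\<^sup>+z. ennreal C * ennreal \<bar>f z\<bar> \<partial>lborel)"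
    using C h by (intro nn_integral_mono)
      (auto simp: abs_mult ennreal_mult[symmetric] intro!: ennreal_leI mult_right_mono)
  also have "\<dots> = ennreal C * (\<integral>\<^sup>+z. ennreal \<bar>f z\<bar> \<partial>lborel)"
    by (rule nn_integral_cmult) measurable
  also have "\<dots> \<le> ennreal C * ennreal B" by (rule mult_left_mono[OF f]) simp
  also have "\<dots> = ennreal (C * B)" using C by (simp add: ennreal_mult')
  finally show *: "(\<integral>\<^sup>+z. ennreal \<bar>h (fst z) * f z\<bar> \<partial>lborel) \<le> ennreal (C * B)" .
  show "integrable lborel (\<lambda>z. h (fst z) * f z)"
    using le_less_trans[OF *, of \<infinity>] by (intro integrableI_bounded) auto
qed

text \<open>The coefficients of \<open>dp\<close> and (up to sign) of \<open>dq\<close> in the differential at \<open>\<zeta>\<close> of the angle under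
  which \<open>\<zeta>\<close> is seen from \<open>z\<close>, cut off to a box in \<open>z\<close>.\<close>

definition kernel_dp :: "real \<Rightarrow> real \<Rightarrow> real \<times> real \<Rightarrow> real \<times> real \<Rightarrow> real" where
  "kernel_dp M R \<zeta> z = (fst \<zeta> - fst z) / ((fst \<zeta> - fst z)\<^sup>2 + (snd \<zeta> - snd z)\<^sup>2) * indicator ({-M..M} \<times> {-R..R}) z"

definition kernel_dq :: "real \<Rightarrow> real \<Rightarrow> real \<times> real \<Rightarrow> real \<times> real \<Rightarrow> real" where
  "kernel_dq M R \<zeta> z = (snd \<zeta> - snd z) / ((fst \<zeta> - fst z)\<^sup>2 + (snd \<zeta> - snd z)\<^sup>2) * indicator ({-M..M} \<times> {-R..R}) z"

lemma kernel_measurable [measurable]: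
  "kernel_dp M R \<zeta> \<in> borel_measurable borel" "kernel_dq M R \<zeta> \<in> borel_measurable borel"
  "(\<lambda>(\<zeta>, z). kernel_dp M R \<zeta> z) \<in> borel_measurable borel"
  "(\<lambda>(\<zeta>, z). kernel_dq M R \<zeta> z) \<in> borel_measurable borel"
proof -
  have [measurable]: "{-M..M} \<times> {-R..R} \<in> sets (borel :: (real \<times> real) measure)"
    by (intro borel_closed closed_Times) auto
  show "kernel_dp M R \<zeta> \<in> borel_measurable borel" "kernel_dq M R \<zeta> \<in> borel_measurable borel"
    unfolding kernel_dp_def[abs_def] kernel_dq_def[abs_def] borel_prod[symmetric] by measurable
  show "(\<lambda>(\<zeta>, z). kernel_dp M R \<zeta> z) \<in> borel_measurable borel"
    "(\<lambda>(\<zeta>, z). kernel_dq M R \<zeta> z) \<in> borel_measurable borel"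
    unfolding kernel_dp_def[abs_def] kernel_dq_def[abs_def] borel_prod[symmetric] by measurable
qed

lemma nn_integral_kernel_le:
  assumes "M \<ge> 0" "R \<ge> 0"
  shows "(\<integral>\<^sup>+z. ennreal \<bar>kernel_dp M R \<zeta> z\<bar> \<partial>lborel) \<le> ennreal (2 * M * pi)"
    and "(\<integral>\<^sup>+z. ennreal \<bar>kernel_dq M R \<zeta> z\<bar> \<partial>lborel) \<le> ennreal (2 * R * pi)"
  using nn_integral_planar_kernel_le[OF assms, where x = "fst \<zeta>" and y = "snd \<zeta>"]
  by (simp_all add: kernel_dp_def kernel_dq_def abs_mult abs_divide)

lemma integral_kernel_dp:
  fixes h :: "real \<Rightarrow> real"
  assumes [measurable]: "h \<in> borel_measurable borel" and h: "\<And>a. \<bar>h a\<bar> \<le> C" and MR: "M \<ge> 0" "R \<ge> 0"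
  shows "(LINT z|lborel. h (fst z) * kernel_dp M R (x, y) z)
    = (LINT a:{-M..M}|lborel. h a * (arctan ((y + R) / (x - a)) - arctan ((y - R) / (x - a))))"
proof -
  have "integrable (lborel \<Otimes>\<^sub>M lborel) (\<lambda>z. h (fst z) * kernel_dp M R (x, y) z)"
    unfolding lborel_prod
    by (rule planar_kernel_bounded_factor(2)[OF _ _ h nn_integral_kernel_le(1)[OF MR]]) measurable
  from lborel_pair.integral_fst'[OF this]
  have "(LINT z|lborel. h (fst z) * kernel_dp M R (x, y) z)
      = (LINT a|lborel. LINT b|lborel. h a * kernel_dp M R (x, y) (a, b))"
    by (simp add: lborel_prod)
  moreover have "(LINT b|lborel. h a * kernel_dp M R (x, y) (a, b))
      = indicator {-M..M} a *\<^sub>R (h a * (arctan ((y + R) / (x - a)) - arctan ((y - R) / (x - a))))" for a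
  proof -
    have "h a * kernel_dp M R (x, y) (a, b)
        = (indicator {-M..M} a * h a) * ((x - a) / ((x - a)\<^sup>2 + (y - b)\<^sup>2) * indicator {-R..R} b)" for b
      by (simp add: kernel_dp_def indicator_times)
    then show ?thesis
      using has_bochner_integral_integral_eq[OF has_bochner_integral_arctan_kernel[OF MR(2), of "x - a" y]]
      by (simp only: integral_mult_right_zero real_scaleR_def mult.assoc)
  qed
  ultimately show ?thesis unfolding set_lebesgue_integral_def by (simp only:)
qed

lemma integral_kernel_dq:
  fixes h :: "real \<Rightarrow> real"
  assumes [measurable]: "h \<in> borel_measurable borel" and h: "\<And>a. \<bar>h a\<bar> \<le> C" and MR: "M \<ge> 0" "R \<ge> 0"
  shows "(LINT z|lborel. h (fst z) * kernel_dq M R (x, y) z)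
    = (LINT a:{-M..M}|lborel. h a * ((ln ((x - a)\<^sup>2 + (y + R)\<^sup>2) - ln ((x - a)\<^sup>2 + (y - R)\<^sup>2)) / 2))"
proof -
  have "integrable (lborel \<Otimes>\<^sub>M lborel) (\<lambda>z. h (fst z) * kernel_dq M R (x, y) z)"
    unfolding lborel_prod
    by (rule planar_kernel_bounded_factor(2)[OF _ _ h nn_integral_kernel_le(2)[OF MR]]) measurable
  from lborel_pair.integral_fst'[OF this]
  have "(LINT z|lborel. h (fst z) * kernel_dq M R (x, y) z)
      = (LINT a|lborel. LINT b|lborel. h a * kernel_dq M R (x, y) (a, b))"
    by (simp add: lborel_prod)
  also have "\<dots> = (LINT a|lborel. indicator {-M..M} a *\<^sub>R (h a * ((ln ((x - a)\<^sup>2 + (y + R)\<^sup>2) - ln ((x - a)\<^sup>2 + (y - R)\<^sup>2)) / 2)))"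
  proof (rule integral_cong_AE)
    show "AE a in lborel. (LINT b|lborel. h a * kernel_dq M R (x, y) (a, b)) =
        indicator {-M..M} a *\<^sub>R (h a * ((ln ((x - a)\<^sup>2 + (y + R)\<^sup>2) - ln ((x - a)\<^sup>2 + (y - R)\<^sup>2)) / 2))"
      using AE_lborel_neq[of x]
    proof eventually_elim
      case (elim a)
      then have "x - a \<noteq> 0" by simp
      have "h a * kernel_dq M R (x, y) (a, b)
          = (indicator {-M..M} a * h a) * ((y - b) / ((x - a)\<^sup>2 + (y - b)\<^sup>2) * indicator {-R..R} b)" for b
        by (simp add: kernel_dq_def indicator_times)
      then show ?case
        using has_bochner_integral_integral_eq[OF has_bochner_integral_ln_kernel[OF MR(2) \<open>x - a \<noteq> 0\<close>, of y]]
        by (simp only: integral_mult_right_zero real_scaleR_def mult.assoc)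
    qed
    have [measurable]: "(\<lambda>z. h (fst z) * kernel_dq M R (x, y) z) \<in> borel_measurable (lborel \<Otimes>\<^sub>M lborel)"
      unfolding lborel_prod by measurable
    show "(\<lambda>a. LINT b|lborel. h a * kernel_dq M R (x, y) (a, b)) \<in> borel_measurable lborel"
      using lborel.borel_measurable_lebesgue_integral[of "\<lambda>a b. h a * kernel_dq M R (x, y) (a, b)" lborel]
        \<open>(\<lambda>z. h (fst z) * kernel_dq M R (x, y) z) \<in> _\<close>
      by (simp add: case_prod_beta')
  qed measurable
  finally show ?thesis by (simp add: set_lebesgue_integral_def)
qed

lemma abs_set_integral_le:
  fixes f :: "real \<Rightarrow> real"
  assumes "AE a in lborel. \<bar>f a\<bar> \<le> B" and "f \<in> borel_measurable borel" and "M \<ge> 0"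
  shows "\<bar>LINT a:{-M..M}|lborel. f a\<bar> \<le> 2 * M * B"
proof -
  have int: "integrable lborel (\<lambda>a. indicator {-M..M} a *\<^sub>R B)"
    by (intro integrable_scaleR_left) (simp add: emeasure_lborel_Icc_eq)
  have bnd: "AE a in lborel. \<bar>indicator {-M..M} a *\<^sub>R f a\<bar> \<le> indicator {-M..M} a *\<^sub>R B"
    using assms(1) by eventually_elim (auto simp: indicator_def)
  have "\<bar>LINT a:{-M..M}|lborel. f a\<bar> \<le> (LINT a|lborel. \<bar>indicator {-M..M} a *\<^sub>R f a\<bar>)"
    unfolding set_lebesgue_integral_def by (rule integral_abs_bound)
  also have "\<dots> \<le> (LINT a|lborel. indicator {-M..M} a *\<^sub>R B)"
  proof (rule integral_mono_AE[OF _ int bnd])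
    show "integrable lborel (\<lambda>a. \<bar>indicator {-M..M} a *\<^sub>R f a\<bar>)"
    proof (rule Bochner_Integration.integrable_bound[OF int])
      show "AE a in lborel. norm \<bar>indicator {-M..M} a *\<^sub>R f a\<bar> \<le> norm (indicator {-M..M} a *\<^sub>R B)"
        using bnd by eventually_elim simp
    qed (use assms(2) in measurable)
  qed
  also have "\<dots> = 2 * M * B" using assms(3) by simp
  finally show ?thesis .
qed

text \<open>Integrating \<open>h = g'\<close> against \<open>sgn(x - a)\<close> counts the increment of \<open>g\<close> up to \<open>x\<close> positively and
  the one after \<open>x\<close> negatively; this is how \<open>g(x)\<close> enters Green's theorem.\<close>

lemma integral_sgn_derivative:
  fixes g h :: "real \<Rightarrow> real"
  assumes [measurable]: "h \<in> borel_measurable borel" and h: "\<And>a. \<bar>h a\<bar> \<le> C"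
    and g: "\<And>a b. a \<le> b \<Longrightarrow> (h has_integral (g b - g a)) {a..b}" and x: "\<bar>x\<bar> \<le> M"
  shows "(LINT a:{-M..M}|lborel. h a * (pi * sgn (x - a))) = pi * (2 * g x - g M - g (- M))"
proof -
  have C: "C \<ge> 0" using h[of 0] by simp
  have "(h has_integral (g x - g (- M))) {-M..x}" using x by (intro g) auto
  from has_integral_mult_right[OF this, of pi]
  have 1: "((\<lambda>a. h a * (pi * sgn (x - a))) has_integral (pi * (g x - g (- M)))) {-M..x}"
    by (rule has_integral_spike[of "{x}", rotated 2]) auto
  have "(h has_integral (g M - g x)) {x..M}" using x by (intro g) auto
  from has_integral_mult_right[OF this, of "- pi"]
  have 2: "((\<lambda>a. h a * (pi * sgn (x - a))) has_integral (- pi * (g M - g x))) {x..M}"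
    by (rule has_integral_spike[of "{x}", rotated 2]) auto
  have "((\<lambda>a. h a * (pi * sgn (x - a))) has_integral (pi * (g x - g (- M)) + - pi * (g M - g x))) {-M..M}"
    by (rule has_integral_combine[OF _ _ 1 2]) (use x in auto)
  moreover have "(LINT a:{-M..M}|lborel. h a * (pi * sgn (x - a))) = integral {-M..M} (\<lambda>a. h a * (pi * sgn (x - a)))"
  proof (rule set_borel_integral_eq_integral(2), rule set_integrable_bounded_interval[where C = "C * pi"])
    show "\<bar>h a * (pi * sgn (x - a))\<bar> \<le> C * pi" for a
      using h[of a] C by (auto simp: abs_mult sgn_if)
  qed measurable
  ultimately have "(LINT a:{-M..M}|lborel. h a * (pi * sgn (x - a)))
      = pi * (g x - g (- M)) + - pi * (g M - g x)"
    using integral_unique by metis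
  then show ?thesis by (simp add: algebra_simps)
qed


text \<open>The half-heights \<open>2 M + 1 + n\<close> of the boxes tend to infinity and satisfy the hypothesis of
  \<open>abs_ln_kernel_le\<close> from the start, so that dominated convergence applies. The two bounds serve
  as dominating constants for a second limit, along the path.\<close>

lemma tendsto_integral_kernel:
  fixes g h :: "real \<Rightarrow> real"
  assumes [measurable]: "h \<in> borel_measurable borel" and h: "\<And>a. \<bar>h a\<bar> \<le> C"
    and g: "\<And>a b. a \<le> b \<Longrightarrow> (h has_integral (g b - g a)) {a..b}"
    and x: "\<bar>x\<bar> \<le> M" and y: "\<bar>y\<bar> \<le> M"
  shows "(\<lambda>n. LINT z|lborel. h (fst z) * kernel_dp M (2 * M + 1 + real n) (x, y) z)
      \<longlonglongrightarrow> pi * (2 * g x - g M - g (- M))"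
    and "(\<lambda>n. LINT z|lborel. h (fst z) * kernel_dq M (2 * M + 1 + real n) (x, y) z) \<longlonglongrightarrow> 0"
    and "\<bar>LINT z|lborel. h (fst z) * kernel_dp M (2 * M + 1 + real n) (x, y) z\<bar> \<le> 2 * M * (C * (2 * pi))"
    and "\<bar>LINT z|lborel. h (fst z) * kernel_dq M (2 * M + 1 + real n) (x, y) z\<bar> \<le> 2 * M * (C * 4)"
proof -
  have C: "C \<ge> 0" using h[of 0] by simp
  have M: "M \<ge> 0" and R: "2 * M + 1 + real n \<ge> 0" for n using x by auto
  define A where "A = (\<lambda>n a. arctan ((y + (2 * M + 1 + real n)) / (x - a)) - arctan ((y - (2 * M + 1 + real n)) / (x - a)))"
  define B where "B = (\<lambda>n a. (ln ((x - a)\<^sup>2 + (y + (2 * M + 1 + real n))\<^sup>2) - ln ((x - a)\<^sup>2 + (y - (2 * M + 1 + real n))\<^sup>2)) / 2)"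
  have [measurable]: "A n \<in> borel_measurable borel" "B n \<in> borel_measurable borel" for n
    unfolding A_def B_def by measurable
  have eqA: "(LINT z|lborel. h (fst z) * kernel_dp M (2 * M + 1 + real n) (x, y) z) = (LINT a:{-M..M}|lborel. h a * A n a)" for n
    unfolding A_def by (rule integral_kernel_dp[OF _ h M R]) measurable
  have eqB: "(LINT z|lborel. h (fst z) * kernel_dq M (2 * M + 1 + real n) (x, y) z) = (LINT a:{-M..M}|lborel. h a * B n a)" for n
    unfolding B_def by (rule integral_kernel_dq[OF _ h M R]) measurable
  have bA: "\<bar>h a * A n a\<bar> \<le> C * (2 * pi)" for n a
  proof -
    have "\<bar>A n a\<bar> \<le> 2 * pi"
      using arctan_bounded[of "(y + (2 * M + 1 + real n)) / (x - a)"] arctan_bounded[of "(y - (2 * M + 1 + real n)) / (x - a)"]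
      unfolding A_def by linarith
    then show ?thesis using h[of a] C by (auto simp: abs_mult intro!: mult_mono)
  qed
  have bB: "AE a in lborel. \<bar>h a * B n a\<bar> \<le> C * 4" for n
    using AE_lborel_neq[of x]
  proof eventually_elim
    case (elim a)
    have "\<bar>B n a\<bar> \<le> 4"
      unfolding B_def by (rule abs_ln_kernel_le[OF _ y]) (use elim M in auto)
    then show ?case using h[of a] C by (auto simp: abs_mult intro!: mult_mono)
  qed
  have int: "integrable lborel (\<lambda>a. indicator {-M..M} a *\<^sub>R K)" for K :: real
    by (intro integrable_scaleR_left) (simp add: emeasure_lborel_Icc_eq)
  have "(\<lambda>n. LINT a:{-M..M}|lborel. h a * A n a) \<longlonglongrightarrow> (LINT a:{-M..M}|lborel. h a * (pi * sgn (x - a)))"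
    unfolding set_lebesgue_integral_def
  proof (rule integral_dominated_convergence[where w = "\<lambda>a. indicator {-M..M} a *\<^sub>R (C * (2 * pi))"])
    show "AE a in lborel. (\<lambda>n. indicator {-M..M} a *\<^sub>R (h a * A n a)) \<longlonglongrightarrow> indicator {-M..M} a *\<^sub>R (h a * (pi * sgn (x - a)))"
      unfolding A_def by (intro AE_I2 tendsto_intros tendsto_arctan_kernel)
    show "AE a in lborel. norm (indicator {-M..M} a *\<^sub>R (h a * A n a)) \<le> indicator {-M..M} a *\<^sub>R (C * (2 * pi))" for n
      using bA by (auto simp: indicator_def)
  qed (use int in measurable)
  then show "(\<lambda>n. LINT z|lborel. h (fst z) * kernel_dp M (2 * M + 1 + real n) (x, y) z)
      \<longlonglongrightarrow> pi * (2 * g x - g M - g (- M))"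
    unfolding eqA using integral_sgn_derivative[OF assms(1) h g x] by simp
  have "(\<lambda>n. LINT a:{-M..M}|lborel. h a * B n a) \<longlonglongrightarrow> (LINT a:{-M..M}|lborel. 0)"
    unfolding set_lebesgue_integral_def
  proof (rule integral_dominated_convergence[where w = "\<lambda>a. indicator {-M..M} a *\<^sub>R (C * 4)"])
    show "AE a in lborel. (\<lambda>n. indicator {-M..M} a *\<^sub>R (h a * B n a)) \<longlonglongrightarrow> indicator {-M..M} a *\<^sub>R 0"
      using AE_lborel_neq[of x]
    proof eventually_elim
      case (elim a)
      have "(\<lambda>n. B n a) \<longlonglongrightarrow> 0"
        unfolding B_def by (rule tendsto_ln_kernel) (use elim in simp)
      then have "(\<lambda>n. indicator {-M..M} a *\<^sub>R (h a * B n a)) \<longlonglongrightarrow> indicator {-M..M} a *\<^sub>R (h a * 0)"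
        by (intro tendsto_intros)
      then show ?case by simp
    qed
    show "AE a in lborel. norm (indicator {-M..M} a *\<^sub>R (h a * B n a)) \<le> indicator {-M..M} a *\<^sub>R (C * 4)" for n
      using bB[of n] by eventually_elim (auto simp: indicator_def)
  qed (use int in measurable)
  then show "(\<lambda>n. LINT z|lborel. h (fst z) * kernel_dq M (2 * M + 1 + real n) (x, y) z) \<longlonglongrightarrow> 0"
    unfolding eqB by (simp add: set_lebesgue_integral_def)
  show "\<bar>LINT z|lborel. h (fst z) * kernel_dp M (2 * M + 1 + real n) (x, y) z\<bar> \<le> 2 * M * (C * (2 * pi))"
    unfolding eqA by (rule abs_set_integral_le[OF _ _ M]) (use bA in auto)
  show "\<bar>LINT z|lborel. h (fst z) * kernel_dq M (2 * M + 1 + real n) (x, y) z\<bar> \<le> 2 * M * (C * 4)"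
    unfolding eqB by (rule abs_set_integral_le[OF bB _ M]) measurable
qed

text \<open>The bound on the integral of \<open>f\<close> over the plane is uniform in the base point, so Tonelli's theorem
  gives joint integrability for a base point that moves along a path.\<close>

lemma integrable_along_path:
  fixes f :: "real \<times> real \<Rightarrow> real \<times> real \<Rightarrow> real" and V X Y :: "real \<Rightarrow> real"
  assumes [measurable]: "(\<lambda>(\<zeta>, z). f \<zeta> z) \<in> borel_measurable borel"
    "V \<in> borel_measurable borel" "X \<in> borel_measurable borel" "Y \<in> borel_measurable borel"
    and V: "\<And>t. \<bar>V t\<bar> \<le> D" and f: "\<And>\<zeta>. (\<integral>\<^sup>+z. ennreal \<bar>f \<zeta> z\<bar> \<partial>lborel) \<le> ennreal B"
  shows "integrable (lborel \<Otimes>\<^sub>M lborel) (\<lambda>(t, z). indicator {0..1} t * (V t * f (X t, Y t) z))"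
proof (rule integrableI_bounded)
  have D: "D \<ge> 0" using V[of 0] by simp
  have F [measurable]: "(\<lambda>(\<zeta>, z). f \<zeta> z) \<in> borel_measurable (borel \<Otimes>\<^sub>M borel)"
    using assms(1) by (simp add: borel_prod)
  have [measurable]: "(\<lambda>t. (X t, Y t)) \<in> borel_measurable borel"
    unfolding borel_prod[symmetric] by measurable
  have "(\<lambda>p. ((X (fst p), Y (fst p)), snd p)) \<in> measurable (lborel \<Otimes>\<^sub>M lborel) (borel \<Otimes>\<^sub>M borel)"
    by measurable
  from measurable_compose[OF this F]
  have 1 [measurable]: "(\<lambda>p. f (X (fst p), Y (fst p)) (snd p)) \<in> borel_measurable (lborel \<Otimes>\<^sub>M lborel)"
    by simp
  show *: "(\<lambda>(t, z). indicator {0..1} t * (V t * f (X t, Y t) z)) \<in> borel_measurable (lborel \<Otimes>\<^sub>M lborel)"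
    unfolding case_prod_beta' by measurable
  have [measurable]: "f \<zeta> \<in> borel_measurable borel" for \<zeta>
    using measurable_Pair2[OF F, of \<zeta>] by simp
  have "(\<integral>\<^sup>+p. ennreal (norm ((\<lambda>(t, z). indicator {0..1} t * (V t * f (X t, Y t) z)) p)) \<partial>(lborel \<Otimes>\<^sub>M lborel))
    = (\<integral>\<^sup>+t. \<integral>\<^sup>+z. ennreal (indicator {0..1} t * \<bar>V t\<bar>) * ennreal \<bar>f (X t, Y t) z\<bar> \<partial>lborel \<partial>lborel)"
    using * by (subst lborel.nn_integral_fst[symmetric])
      (auto simp: abs_mult ennreal_mult[symmetric] mult.assoc)
  also have "\<dots> = (\<integral>\<^sup>+t. ennreal (indicator {0..1} t * \<bar>V t\<bar>) * (\<integral>\<^sup>+z. ennreal \<bar>f (X t, Y t) z\<bar> \<partial>lborel) \<partial>lborel)"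
    by (intro nn_integral_cong nn_integral_cmult) measurable
  also have "\<dots> \<le> (\<integral>\<^sup>+t. ennreal (D * B) * indicator {0..1::real} t \<partial>lborel)"
  proof (rule nn_integral_mono)
    fix t
    have "ennreal (indicator {0..1} t * \<bar>V t\<bar>) * (\<integral>\<^sup>+z. ennreal \<bar>f (X t, Y t) z\<bar> \<partial>lborel)
      \<le> ennreal (indicator {0..1} t * D) * ennreal B"
      using V f by (intro mult_mono ennreal_leI mult_left_mono) auto
    also have "\<dots> = ennreal (D * B) * indicator {0..1} t"
      using D by (auto simp: indicator_def ennreal_mult')
    finally show "ennreal (indicator {0..1} t * \<bar>V t\<bar>) * (\<integral>\<^sup>+z. ennreal \<bar>f (X t, Y t) z\<bar> \<partial>lborel)
      \<le> ennreal (D * B) * indicator {0..1} t" .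
  qed
  also have "\<dots> < \<infinity>" by (simp add: nn_integral_cmult_indicator)
  finally show "(\<integral>\<^sup>+p. ennreal (norm ((\<lambda>(t, z). indicator {0..1} t * (V t * f (X t, Y t) z)) p)) \<partial>(lborel \<Otimes>\<^sub>M lborel)) < \<infinity>" .
qed

section \<open>Integrating winding numbers\<close>

text \<open>The winding number appears only through the values of its integral, as an abstract bounded-support
  function \<open>w\<close>. Because \<open>w\<close> vanishes outside the box of side \<open>2 M\<close>, the left-hand side does not depend
  on the height of the box used for Fubini's theorem, and that height may tend to infinity. In the
  limit the constant part of \<open>integral_sgn_derivative\<close> is multiplied by the integral of \<open>Y'\<close>, which
  is \<open>0\<close> for a loop.\<close>

lemma integral_winding_kernel:
  fixes X Y X' Y' g h :: "real \<Rightarrow> real" and w :: "real \<times> real \<Rightarrow> real"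
  assumes meas [measurable]: "X \<in> borel_measurable borel" "Y \<in> borel_measurable borel"
      "X' \<in> borel_measurable borel" "Y' \<in> borel_measurable borel"
      "h \<in> borel_measurable borel" "w \<in> borel_measurable borel"
    and XY: "\<And>t. \<bar>X t\<bar> \<le> M" "\<And>t. \<bar>Y t\<bar> \<le> M" and D: "\<And>t. \<bar>X' t\<bar> \<le> D" "\<And>t. \<bar>Y' t\<bar> \<le> D"
    and closed: "(LINT t:{0..1}|lborel. Y' t) = 0"
    and h: "\<And>a. \<bar>h a\<bar> \<le> C" and g: "\<And>a b. a \<le> b \<Longrightarrow> (h has_integral (g b - g a)) {a..b}"
    and g_cont: "continuous_on UNIV g"
    and w0: "\<And>z. z \<notin> {-M..M} \<times> {-M..M} \<Longrightarrow> w z = 0"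
    and w: "AE z in lborel. (LINT t:{0..1}|lborel.
        Y' t * ((X t - fst z) / ((X t - fst z)\<^sup>2 + (Y t - snd z)\<^sup>2))
        - X' t * ((Y t - snd z) / ((X t - fst z)\<^sup>2 + (Y t - snd z)\<^sup>2))) = 2 * pi * w z"
  shows "(LINT z|lborel. w z * h (fst z)) = (LINT t:{0..1}|lborel. g (X t) * Y' t)"
proof -
  have M: "M \<ge> 0" and C: "C \<ge> 0" and D0: "D \<ge> 0" using XY(1)[of 0] h[of 0] D(1)[of 0] by auto
  define R where "R = (\<lambda>n. 2 * M + 1 + real n)"
  have R: "R n \<ge> 0" "R n \<ge> M" for n using M by (auto simp: R_def)
  define P where "P = (\<lambda>n \<zeta> z. h (fst z) * kernel_dp M (R n) \<zeta> z)"
  define Q where "Q = (\<lambda>n \<zeta> z. h (fst z) * kernel_dq M (R n) \<zeta> z)"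
  have g_meas [measurable]: "g \<in> borel_measurable borel"
    using g_cont by (rule borel_measurable_continuous_onI)
  have P_meas: "(\<lambda>(\<zeta>, z). P n \<zeta> z) \<in> borel_measurable borel" for n
    using kernel_measurable(3)[of M "R n"] unfolding P_def case_prod_beta' borel_prod[symmetric] by measurable
  have Q_meas: "(\<lambda>(\<zeta>, z). Q n \<zeta> z) \<in> borel_measurable borel" for n
    using kernel_measurable(4)[of M "R n"] unfolding Q_def case_prod_beta' borel_prod[symmetric] by measurable
  have P_nn: "(\<integral>\<^sup>+z. ennreal \<bar>P n \<zeta> z\<bar> \<partial>lborel) \<le> ennreal (C * (2 * M * pi))" for n \<zeta>
    unfolding P_def by (rule planar_kernel_bounded_factor(1)[OF _ _ h nn_integral_kernel_le(1)[OF M R(1)]]) measurable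
  have Q_nn: "(\<integral>\<^sup>+z. ennreal \<bar>Q n \<zeta> z\<bar> \<partial>lborel) \<le> ennreal (C * (2 * R n * pi))" for n \<zeta>
    unfolding Q_def by (rule planar_kernel_bounded_factor(1)[OF _ _ h nn_integral_kernel_le(2)[OF M R(1)]]) measurable
  have P_int: "integrable lborel (P n \<zeta>)" for n \<zeta>
    unfolding P_def by (rule planar_kernel_bounded_factor(2)[OF _ _ h nn_integral_kernel_le(1)[OF M R(1)]]) measurable
  have Q_int: "integrable lborel (Q n \<zeta>)" for n \<zeta>
    unfolding Q_def by (rule planar_kernel_bounded_factor(2)[OF _ _ h nn_integral_kernel_le(2)[OF M R(1)]]) measurable
  define k where "k = (\<lambda>n t z. indicator {0..1} t * (Y' t * P n (X t, Y t) z)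
      - indicator {0..1} t * (X' t * Q n (X t, Y t) z))"
  have k_int: "integrable (lborel \<Otimes>\<^sub>M lborel) (\<lambda>(t, z). k n t z)" for n
  proof -
    have "integrable (lborel \<Otimes>\<^sub>M lborel) (\<lambda>(t, z). indicator {0..1} t * (Y' t * P n (X t, Y t) z))"
      by (rule integrable_along_path[OF P_meas _ _ _ D(2) P_nn]) measurable
    moreover have "integrable (lborel \<Otimes>\<^sub>M lborel) (\<lambda>(t, z). indicator {0..1} t * (X' t * Q n (X t, Y t) z))"
      by (rule integrable_along_path[OF Q_meas _ _ _ D(1) Q_nn]) measurable
    ultimately show ?thesis unfolding k_def case_prod_beta' by (rule Bochner_Integration.integrable_diff)
  qed
  have inner_z: "(LINT z|lborel. k n t z) = indicator {0..1} t *\<^sub>R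
      (Y' t * (LINT z|lborel. P n (X t, Y t) z) - X' t * (LINT z|lborel. Q n (X t, Y t) z))" for n t
    using P_int Q_int by (simp add: k_def algebra_simps)
  have inner_t: "AE z in lborel. (LINT t|lborel. k n t z) = 2 * pi * (w z * h (fst z))" for n
    using w
  proof eventually_elim
    case (elim z)
    have "k n t z = (h (fst z) * indicator ({-M..M} \<times> {-R n..R n}) z) * (indicator {0..1} t *\<^sub>R
       (Y' t * ((X t - fst z) / ((X t - fst z)\<^sup>2 + (Y t - snd z)\<^sup>2))
        - X' t * ((Y t - snd z) / ((X t - fst z)\<^sup>2 + (Y t - snd z)\<^sup>2))))" for t
      unfolding k_def P_def Q_def kernel_dp_def kernel_dq_def fst_conv snd_conv real_scaleR_def
      by (simp only: right_diff_distrib mult_ac)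
    then have "(LINT t|lborel. k n t z) = (h (fst z) * indicator ({-M..M} \<times> {-R n..R n}) z) * (2 * pi * w z)"
      using elim unfolding set_lebesgue_integral_def by (simp only: integral_mult_right_zero)
    moreover have "w z = 0" if "z \<notin> {-M..M} \<times> {-R n..R n}"
      using that R[of n] by (intro w0) auto
    ultimately show ?case by (cases "z \<in> {-M..M} \<times> {-R n..R n}") auto
  qed
  have main: "2 * pi * (LINT z|lborel. w z * h (fst z)) = (LINT t|lborel. indicator {0..1} t *\<^sub>R
      (Y' t * (LINT z|lborel. P n (X t, Y t) z) - X' t * (LINT z|lborel. Q n (X t, Y t) z)))" for n
  proof -
    have "2 * pi * (LINT z|lborel. w z * h (fst z)) = (LINT z|lborel. 2 * pi * (w z * h (fst z)))"
      by (rule integral_mult_right_zero[symmetric])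
    also have "\<dots> = (LINT z|lborel. LINT t|lborel. k n t z)"
    proof (rule integral_cong_AE)
      show "AE z in lborel. 2 * pi * (w z * h (fst z)) = (LINT t|lborel. k n t z)"
        using inner_t[of n] by eventually_elim simp
      have "(\<lambda>(z, t). k n t z) \<in> borel_measurable (lborel \<Otimes>\<^sub>M lborel)"
        using borel_measurable_integrable[OF k_int[of n]]
        by (subst measurable_pair_swap_iff) (simp add: case_prod_beta')
      then show "(\<lambda>z. LINT t|lborel. k n t z) \<in> borel_measurable lborel"
        by (rule lborel.borel_measurable_lebesgue_integral)
    qed measurable
    also have "\<dots> = (LINT t|lborel. LINT z|lborel. k n t z)"
      by (rule lborel_pair.Fubini_integral[OF k_int])
    finally show ?thesis by (simp only: inner_z)
  qed
  have "(\<lambda>n. LINT t|lborel. indicator {0..1} t *\<^sub>R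
      (Y' t * (LINT z|lborel. P n (X t, Y t) z) - X' t * (LINT z|lborel. Q n (X t, Y t) z)))
    \<longlonglongrightarrow> (LINT t|lborel. indicator {0..1} t *\<^sub>R (Y' t * (pi * (2 * g (X t) - g M - g (- M)))))"
  proof (rule integral_dominated_convergence[where
        w = "\<lambda>t. indicator {0..1} t *\<^sub>R (D * (2 * M * (C * (2 * pi))) + D * (2 * M * (C * 4)))"])
    show "integrable lborel (\<lambda>t::real. indicator {0..1} t *\<^sub>R (D * (2 * M * (C * (2 * pi))) + D * (2 * M * (C * 4))))"
      by (intro integrable_scaleR_left) (simp add: emeasure_lborel_Icc_eq)
    show "AE t in lborel. (\<lambda>n. indicator {0..1} t *\<^sub>R
      (Y' t * (LINT z|lborel. P n (X t, Y t) z) - X' t * (LINT z|lborel. Q n (X t, Y t) z)))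
      \<longlonglongrightarrow> indicator {0..1} t *\<^sub>R (Y' t * (pi * (2 * g (X t) - g M - g (- M))))"
    proof (rule AE_I2)
      fix t
      have "(\<lambda>n. indicator {0..1} t *\<^sub>R
        (Y' t * (LINT z|lborel. P n (X t, Y t) z) - X' t * (LINT z|lborel. Q n (X t, Y t) z)))
        \<longlonglongrightarrow> indicator {0..1} t *\<^sub>R (Y' t * (pi * (2 * g (X t) - g M - g (- M))) - X' t * 0)"
        unfolding P_def Q_def R_def
        by (intro tendsto_intros tendsto_integral_kernel(1,2)[OF meas(5) h g XY])
      then show "(\<lambda>n. indicator {0..1} t *\<^sub>R
        (Y' t * (LINT z|lborel. P n (X t, Y t) z) - X' t * (LINT z|lborel. Q n (X t, Y t) z)))
        \<longlonglongrightarrow> indicator {0..1} t *\<^sub>R (Y' t * (pi * (2 * g (X t) - g M - g (- M))))" by simp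
    qed
    show "AE t in lborel. norm (indicator {0..1} t *\<^sub>R
      (Y' t * (LINT z|lborel. P n (X t, Y t) z) - X' t * (LINT z|lborel. Q n (X t, Y t) z)))
      \<le> indicator {0..1} t *\<^sub>R (D * (2 * M * (C * (2 * pi))) + D * (2 * M * (C * 4)))" for n
    proof (rule AE_I2)
      fix t
      have "\<bar>Y' t * (LINT z|lborel. P n (X t, Y t) z)\<bar> \<le> D * (2 * M * (C * (2 * pi)))"
        unfolding abs_mult P_def R_def
        by (intro mult_mono D D0 abs_ge_zero tendsto_integral_kernel(3)[OF meas(5) h g XY])
      moreover have "\<bar>X' t * (LINT z|lborel. Q n (X t, Y t) z)\<bar> \<le> D * (2 * M * (C * 4))"
        unfolding abs_mult Q_def R_def
        by (intro mult_mono D D0 abs_ge_zero tendsto_integral_kernel(4)[OF meas(5) h g XY])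
      ultimately show "norm (indicator {0..1} t *\<^sub>R
        (Y' t * (LINT z|lborel. P n (X t, Y t) z) - X' t * (LINT z|lborel. Q n (X t, Y t) z)))
        \<le> indicator {0..1} t *\<^sub>R (D * (2 * M * (C * (2 * pi))) + D * (2 * M * (C * 4)))"
        by (auto simp: indicator_def intro: order_trans[OF abs_triangle_ineq4] simp del: abs_mult)
    qed
    show "(\<lambda>t. indicator {0..1} t *\<^sub>R
      (Y' t * (LINT z|lborel. P n (X t, Y t) z) - X' t * (LINT z|lborel. Q n (X t, Y t) z)))
      \<in> borel_measurable lborel" for n
      using lborel.borel_measurable_lebesgue_integral[OF borel_measurable_integrable[OF k_int[of n]]]
      by (simp only: inner_z)
  qed measurable
  then have "2 * pi * (LINT z|lborel. w z * h (fst z))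
      = (LINT t|lborel. indicator {0..1} t *\<^sub>R (Y' t * (pi * (2 * g (X t) - g M - g (- M)))))"
    unfolding main[symmetric] by (simp add: LIMSEQ_const_iff)
  also have "\<dots> = (LINT t:{0..1}|lborel. 2 * pi * (g (X t) * Y' t) - pi * (g M + g (- M)) * Y' t)"
    unfolding set_lebesgue_integral_def by (simp add: algebra_simps)
  also have "\<dots> = (LINT t:{0..1}|lborel. 2 * pi * (g (X t) * Y' t)) - (LINT t:{0..1}|lborel. pi * (g M + g (- M)) * Y' t)"
  proof (rule set_integral_diff(2))
    have "bounded (g ` {-M..M})"
      by (intro compact_imp_bounded compact_continuous_image continuous_on_subset[OF g_cont]) auto
    then obtain G where "\<forall>y \<in> g ` {-M..M}. norm y \<le> G" unfolding bounded_iff by blast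
    then have G: "\<And>x. x \<in> {-M..M} \<Longrightarrow> \<bar>g x\<bar> \<le> G" by simp
    show "set_integrable lborel {0..1} (\<lambda>t. 2 * pi * (g (X t) * Y' t))"
    proof (rule set_integrable_bounded_interval)
      show "\<bar>2 * pi * (g (X t) * Y' t)\<bar> \<le> 2 * pi * (G * D)" for t
      proof -
        have "\<bar>g (X t)\<bar> \<le> G" using XY(1)[of t] by (intro G) (auto simp: abs_le_iff)
        then have "\<bar>g (X t)\<bar> * \<bar>Y' t\<bar> \<le> G * D" using D(2)[of t] by (intro mult_mono) auto
        then show ?thesis by (simp add: abs_mult)
      qed
    qed measurable
    show "set_integrable lborel {0..1} (\<lambda>t. pi * (g M + g (- M)) * Y' t)"
      by (rule set_integrable_bounded_interval[where C = "\<bar>pi * (g M + g (- M))\<bar> * D"])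
        (use D(2) in \<open>auto simp: abs_mult intro!: mult_left_mono\<close>)
  qed
  also have "\<dots> = 2 * pi * (LINT t:{0..1}|lborel. g (X t) * Y' t)"
    using closed by simp
  finally show ?thesis by simp
qed

section \<open>Piecewise continuously differentiable contours\<close>

lemma consecutive_breakpoints:
  fixes B :: "real set"
  assumes "finite B" "{0, 1} \<subseteq> B" "t \<in> {0..1}" "t \<notin> B"
  obtains a b where "a \<in> B" "b \<in> B" "a < t" "t < b" "{a<..<b} \<inter> B = {}"
proof -
  have t: "0 < t" "t < 1" using assms by (auto simp: less_le)
  define A where "A = {x \<in> B. x < t}"
  define A' where "A' = {x \<in> B. t < x}"
  have fin: "finite A" "finite A'" "A \<noteq> {}" "A' \<noteq> {}"
    using assms t by (auto simp: A_def A'_def)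
  have "Max A \<in> A" "Min A' \<in> A'" using fin by (auto intro: Max_in Min_in)
  moreover have "{Max A<..<Min A'} \<inter> B = {}"
  proof -
    have False if x: "x \<in> B" "Max A < x" "x < Min A'" for x
    proof (cases "x < t")
      case True
      then have "x \<in> A" using x by (simp add: A_def)
      then show False using Max_ge[OF fin(1), of x] x by simp
    next
      case False
      then have "x \<in> A'" using x assms(4) by (cases "x = t") (auto simp: A'_def)
      then show False using Min_le[OF fin(2), of x] x by simp
    qed
    then show ?thesis by auto
  qed
  ultimately show ?thesis using that[of "Max A" "Min A'"] by (auto simp: A_def A'_def)
qed

lemma C1_imp_lipschitz:
  fixes \<gamma> :: "real \<Rightarrow> 'a::real_normed_vector"
  assumes D: "continuous_on {a..b} D"
    and \<gamma>: "\<And>t. t \<in> {a..b} \<Longrightarrow> (\<gamma> has_vector_derivative D t) (at t within {a..b})"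
  obtains K where "K-lipschitz_on {a..b} \<gamma>"
proof -
  have "bounded (D ` {a..b})"
    by (intro compact_imp_bounded compact_continuous_image D) simp
  then obtain K where K: "\<forall>v \<in> D ` {a..b}. norm v \<le> K" unfolding bounded_iff by blast
  have "(max K 0)-lipschitz_on {a..b} \<gamma>"
  proof (rule lipschitz_onI)
    fix x y assume xy: "x \<in> {a..b}" "y \<in> {a..b}"
    have "norm (\<gamma> x - \<gamma> y) \<le> max K 0 * norm (x - y)"
    proof (rule differentiable_bound[OF _ _ _ xy])
      show "(\<gamma> has_derivative (\<lambda>h. h *\<^sub>R D t)) (at t within {a..b})" if "t \<in> {a..b}" for t
        using \<gamma>[OF that] by (simp add: has_vector_derivative_def)
      show "onorm (\<lambda>h. h *\<^sub>R D t) \<le> max K 0" if "t \<in> {a..b}" for t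
      proof (rule onorm_bound)
        have "norm (D t) \<le> K" using K that by blast
        then show "norm (x *\<^sub>R D t) \<le> max K 0 * norm x" for x
          by (simp add: mult.commute mult_left_mono)
      qed simp
    qed simp
    then show "dist (\<gamma> x) (\<gamma> y) \<le> max K 0 * dist x y" by (simp add: dist_norm)
  qed simp
  then show ?thesis by (rule that)
qed

text \<open>The closed pieces cover the unit interval, and finitely many Lipschitz estimates on closed sets
  covering an interval combine. Breakpoints are added as degenerate pieces, to save a case
  distinction on whether a piece starts or ends at a given breakpoint.\<close>

lemma piecewise_C1_path_lipschitz:
  assumes "piecewise_C1_path \<gamma>"
  obtains K where "K-lipschitz_on {0..1} \<gamma>"
proof -
  obtain B where B: "finite B" "{0, 1} \<subseteq> B" "B \<subseteq> {0..1}"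
    and pieces: "\<And>a b. a \<in> B \<Longrightarrow> b \<in> B \<Longrightarrow> a < b \<Longrightarrow> {a<..<b} \<inter> B = {} \<Longrightarrow>
        \<exists>D. continuous_on {a..b} D \<and>
          (\<forall>t\<in>{a..b}. (\<gamma> has_vector_derivative D t) (at t within {a..b}))"
    using assms unfolding piecewise_C1_path_def by metis
  define I where "I = {(a, b) \<in> B \<times> B. a = b \<or> a < b \<and> {a<..<b} \<inter> B = {}}"
  have finI: "finite I" using B(1) by (auto simp: I_def intro: finite_subset[of _ "B \<times> B"])
  have "\<exists>K. K-lipschitz_on {fst i..snd i} \<gamma>" if i: "i \<in> I" for i
  proof (cases "fst i = snd i")
    case True
    then show ?thesis by (auto intro!: exI[of _ 0] lipschitz_on_singleton)
  next
    case False
    then obtain D where "continuous_on {fst i..snd i} D"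
      "\<forall>t\<in>{fst i..snd i}. (\<gamma> has_vector_derivative D t) (at t within {fst i..snd i})"
      using pieces[of "fst i" "snd i"] i by (auto simp: I_def case_prod_beta')
    then show ?thesis using C1_imp_lipschitz[of "fst i" "snd i" D \<gamma>] by blast
  qed
  then obtain K where K: "\<And>i. i \<in> I \<Longrightarrow> (K i)-lipschitz_on {fst i..snd i} \<gamma>" by metis
  have K0: "K i \<ge> 0" if "i \<in> I" for i using K[OF that] by (rule lipschitz_on_nonneg)
  have "(sum K I)-lipschitz_on {0..1} \<gamma>"
  proof (rule lipschitz_on_closed_Union[of I _ "\<lambda>i. {fst i..snd i}"])
    show "(sum K I)-lipschitz_on {fst i..snd i} \<gamma>" if "i \<in> I" for i
      using K0 that by (intro lipschitz_on_mono[OF K[OF that]] member_le_sum finI) auto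
    show "{0..1} \<subseteq> (\<Union>i\<in>I. {fst i..snd i})"
    proof
      fix t :: real assume t: "t \<in> {0..1}"
      show "t \<in> (\<Union>i\<in>I. {fst i..snd i})"
      proof (cases "t \<in> B")
        case True
        then show ?thesis by (intro UN_I[of "(t, t)"]) (auto simp: I_def)
      next
        case False
        obtain a b where "a \<in> B" "b \<in> B" "a < t" "t < b" "{a<..<b} \<inter> B = {}"
          by (rule consecutive_breakpoints[OF B(1,2) t False])
        then show ?thesis by (intro UN_I[of "(a, b)"]) (auto simp: I_def)
      qed
    qed
  qed (use finI K0 in \<open>auto intro: sum_nonneg\<close>)
  then show ?thesis by (rule that)
qed

lemma piecewise_C1_path_derivative:
  assumes "piecewise_C1_path \<gamma>"
  obtains B where "finite B" "{0, 1} \<subseteq> B"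
    "\<And>t. t \<in> {0..1} - B \<Longrightarrow> \<gamma> differentiable (at t)"
    "\<And>t. t \<in> {0..1} - B \<Longrightarrow> isCont (\<lambda>s. vector_derivative \<gamma> (at s)) t"
proof -
  obtain B where B: "finite B" "{0, 1} \<subseteq> B" "B \<subseteq> {0..1}"
    and pieces: "\<And>a b. a \<in> B \<Longrightarrow> b \<in> B \<Longrightarrow> a < b \<Longrightarrow> {a<..<b} \<inter> B = {} \<Longrightarrow>
        \<exists>D. continuous_on {a..b} D \<and>
          (\<forall>t\<in>{a..b}. (\<gamma> has_vector_derivative D t) (at t within {a..b}))"
    using assms unfolding piecewise_C1_path_def by metis
  have "\<gamma> differentiable (at t) \<and> isCont (\<lambda>s. vector_derivative \<gamma> (at s)) t" if t: "t \<in> {0..1} - B" for t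
  proof -
    have t': "t \<in> {0..1}" "t \<notin> B" using t by auto
    obtain a b where ab: "a \<in> B" "b \<in> B" "a < t" "t < b" "{a<..<b} \<inter> B = {}"
      by (rule consecutive_breakpoints[OF B(1,2) t'])
    then obtain D where D: "continuous_on {a..b} D"
        "\<forall>t\<in>{a..b}. (\<gamma> has_vector_derivative D t) (at t within {a..b})"
      using pieces[of a b] by auto
    have der: "(\<gamma> has_vector_derivative D s) (at s)" if s: "s \<in> {a<..<b}" for s
    proof -
      have "(\<gamma> has_vector_derivative D s) (at s within {a..b})" using D(2) s by simp
      then show ?thesis using s by (simp add: at_within_Icc_at)
    qed
    have "isCont D t"
      using D(1) ab by (intro continuous_on_interior[of "{a..b}"]) auto
    moreover have "\<forall>\<^sub>F s in nhds t. vector_derivative \<gamma> (at s) = D s"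
      by (rule eventually_mono[OF eventually_nhds_in_open[of "{a<..<b}" t]])
        (use ab in \<open>auto simp: vector_derivative_at[OF der]\<close>)
    ultimately have "isCont (\<lambda>s. vector_derivative \<gamma> (at s)) t"
      by (simp only: isCont_cong[of "\<lambda>s. vector_derivative \<gamma> (at s)" D])
    then show ?thesis using der[of t] ab by (auto intro: differentiableI_vector)
  qed
  then show ?thesis using that B(1,2) by blast
qed

lemma valid_path_linear_image:
  fixes A :: "real \<times> real \<Rightarrow> complex"
  assumes \<gamma>: "piecewise_C1_path \<gamma>" and A: "bounded_linear A"
  shows "valid_path (\<lambda>t. A (\<gamma> t))"
proof -
  obtain K where K: "K-lipschitz_on {0..1} \<gamma>" by (rule piecewise_C1_path_lipschitz[OF \<gamma>])
  have "continuous_on {0..1} (\<lambda>t. A (\<gamma> t))"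
    using lipschitz_on_continuous_on[OF K] A by (rule bounded_linear.continuous_on[rotated])
  moreover obtain B where B: "finite B"
    "\<And>t. t \<in> {0..1} - B \<Longrightarrow> \<gamma> differentiable (at t)"
    "\<And>t. t \<in> {0..1} - B \<Longrightarrow> isCont (\<lambda>s. vector_derivative \<gamma> (at s)) t"
    by (rule piecewise_C1_path_derivative[OF \<gamma>]) blast
  have der: "((\<lambda>t. A (\<gamma> t)) has_vector_derivative A (vector_derivative \<gamma> (at t))) (at t)"
    if "t \<in> {0..1} - B" for t
    by (rule bounded_linear.has_vector_derivative[OF A]) (use B(2)[OF that] vector_derivative_works in blast)
  have "(\<lambda>t. A (\<gamma> t)) C1_differentiable_on ({0..1} - B)"
    unfolding C1_differentiable_on_def
  proof (intro exI conjI ballI)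
    show "((\<lambda>t. A (\<gamma> t)) has_vector_derivative A (vector_derivative \<gamma> (at t))) (at t)"
      if "t \<in> {0..1} - B" for t using der[OF that] .
    show "continuous_on ({0..1} - B) (\<lambda>t. A (vector_derivative \<gamma> (at t)))"
      by (intro bounded_linear.continuous_on[OF A] continuous_at_imp_continuous_on ballI B(3))
  qed
  ultimately show ?thesis
    unfolding valid_path_def piecewise_C1_differentiable_on_def using B(1) by blast
qed

lemma inside_image_subset:
  fixes F :: "'a::euclidean_space \<Rightarrow> 'b::euclidean_space" and G :: "'b \<Rightarrow> 'a"
  assumes F: "bounded_linear F" and G: "bounded_linear G"
    and GF: "\<And>x. G (F x) = x" and FG: "\<And>y. F (G y) = y"
  shows "F ` inside S \<subseteq> inside (F ` S)"
proof
  fix y assume "y \<in> F ` inside S"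
  then obtain x where x: "y = F x" "x \<notin> S" "bounded (connected_component_set (- S) x)"
    by (auto simp: inside_def)
  have "connected_component_set (- F ` S) (F x) \<subseteq> F ` connected_component_set (- S) x"
  proof
    fix v assume "v \<in> connected_component_set (- F ` S) (F x)"
    then obtain T where T: "connected T" "T \<subseteq> - F ` S" "F x \<in> T" "v \<in> T"
      by (auto simp: connected_component_def)
    have "connected (G ` T)"
      by (intro connected_continuous_image T linear_continuous_on G)
    moreover have "G ` T \<subseteq> - S"
      using T(2) FG by (auto simp: image_iff) (metis ComplD imageI subsetD)
    ultimately have "connected_component (- S) x (G v)"
      unfolding connected_component_def using T(3,4) GF by (intro exI[of _ "G ` T"]) (auto intro: image_eqI[of _ G "F x"])
    then show "v \<in> F ` connected_component_set (- S) x" using FG by (auto intro: image_eqI[of _ F "G v"])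
  qed
  then have "bounded (connected_component_set (- F ` S) (F x))"
    using bounded_linear_image[OF x(3) F] bounded_subset by blast
  moreover have "F x \<notin> F ` S" using x(2) GF by (metis imageE)
  ultimately show "y \<in> inside (F ` S)" using x(1) by (simp add: inside_def)
qed

text \<open>Needed because the contour lives in \<^typ>\<open>real \<times> real\<close>, while winding numbers and the Jordan curve
  theorem refer to \<^typ>\<open>complex\<close>.\<close>

lemma inside_linear_image:
  fixes F :: "'a::euclidean_space \<Rightarrow> 'b::euclidean_space" and G :: "'b \<Rightarrow> 'a"
  assumes F: "bounded_linear F" and G: "bounded_linear G"
    and GF: "\<And>x. G (F x) = x" and FG: "\<And>y. F (G y) = y"
  shows "inside (F ` S) = F ` inside S"
proof
  have "G ` inside (F ` S) \<subseteq> inside (G ` F ` S)"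
    by (rule inside_image_subset[OF G F FG GF])
  then have "G ` inside (F ` S) \<subseteq> inside S" by (simp add: image_image GF)
  then have "F ` G ` inside (F ` S) \<subseteq> F ` inside S" by blast
  then show "inside (F ` S) \<subseteq> F ` inside S" by (simp add: image_image FG)
qed (rule inside_image_subset[OF assms])

lemma bounded_linear_Complex: "bounded_linear (\<lambda>z. Complex (fst z + \<beta> * snd z) (snd z))"
proof -
  have "bounded_linear (\<lambda>z::real \<times> real. complex_of_real (fst z + \<beta> * snd z) + \<i> * complex_of_real (snd z))"
    by (intro bounded_linear_add bounded_linear_const_mult bounded_linear_mult_right
        bounded_linear_compose[OF bounded_linear_of_real] bounded_linear_fst bounded_linear_snd
        bounded_linear_compose[OF bounded_linear_mult_right])
  then show ?thesis by (simp add: Complex_eq)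
qed

text \<open>The segment from a vector \<open>v \<noteq> 0\<close> to its sheared image consists of vectors \<open>v + u \<beta> Im v\<close>, and none
  of these vanishes: if its imaginary part is \<open>0\<close>, it equals \<open>v\<close>. Hence the straight-line homotopy
  between the two loops, seen from the base point, avoids the origin.\<close>

lemma winding_number_shear:
  assumes c: "path c" "pathfinish c = pathstart c" and z: "z \<notin> path_image c"
  shows "winding_number (\<lambda>t. Complex (Re (c t) + \<beta> * Im (c t)) (Im (c t))) (Complex (Re z + \<beta> * Im z) (Im z))
       = winding_number c z"
proof -
  \<comment> \<open>The shear in complex notation.\<close>
  define S where "S = (\<lambda>w. w + complex_of_real (\<beta> * Im w))"
  have S: "Complex (Re w + \<beta> * Im w) (Im w) = S w" for w by (simp add: S_def complex_eq_iff)
  have "winding_number (\<lambda>t. S (c t) - S z) 0 = winding_number (\<lambda>t. c t - z) 0"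
  proof (rule winding_number_loops_linear_eq)
    show "path (\<lambda>t. c t - z)" "path (\<lambda>t. S (c t) - S z)"
      using c(1) unfolding path_def S_def by (auto intro!: continuous_intros)
    show "0 \<notin> closed_segment (c t - z) (S (c t) - S z)" if "t \<in> {0..1}" for t
    proof
      assume "0 \<in> closed_segment (c t - z) (S (c t) - S z)"
      then obtain u where u: "0 = (1 - u) *\<^sub>R (c t - z) + u *\<^sub>R (S (c t) - S z)"
        by (auto simp: in_segment)
      have "Im (c t - z) = 0"
        using arg_cong[OF u, of Im] by (simp add: S_def algebra_simps)
      moreover from this have "Re (c t - z) = 0"
        using arg_cong[OF u, of Re] by (simp add: S_def algebra_simps)
      ultimately have "c t = z" by (simp add: complex_eq_iff)
      then show False using z that by (auto simp: path_image_def)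
    qed
  qed (use c(2) in \<open>auto simp: pathfinish_def pathstart_def\<close>)
  then show ?thesis unfolding S by (simp add: winding_number_offset[symmetric])
qed

text \<open>By Cavalieri's principle: on each line \<open>snd z = y\<close> a shear is a translation.\<close>

lemma lborel_shear: "distr lborel borel (\<lambda>z::real \<times> real. (fst z + \<beta> * snd z, snd z)) = lborel"
proof (rule measure_eqI)
  let ?T = "\<lambda>z::real \<times> real. (fst z + \<beta> * snd z, snd z)"
  have T: "?T \<in> borel_measurable borel" by (intro borel_measurable_continuous_onI continuous_intros)
  fix A assume "A \<in> sets (distr lborel borel ?T)"
  then have A: "A \<in> sets borel" by simp
  have vim: "?T -` A \<in> sets borel" using measurable_sets[OF T A] by simp
  have sec: "(\<lambda>x. (x, y)) -` A \<in> sets borel" for y :: real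
  proof -
    have "(\<lambda>x. (x, y)) \<in> borel_measurable (borel :: real measure)"
      by (intro borel_measurable_continuous_onI continuous_intros)
    from measurable_sets[OF this A] show ?thesis by simp
  qed
  have "emeasure (distr lborel borel ?T) A = emeasure (lborel \<Otimes>\<^sub>M lborel) (?T -` A)"
    using A T by (simp add: emeasure_distr lborel_prod)
  also have "\<dots> = (\<integral>\<^sup>+y. emeasure lborel ((\<lambda>x. (x, y)) -` (?T -` A)) \<partial>lborel)"
    using vim by (intro lborel_pair.emeasure_pair_measure_alt2) (simp only: lborel_prod sets_lborel)
  also have "\<dots> = (\<integral>\<^sup>+y. emeasure lborel ((\<lambda>x. (x, y)) -` A) \<partial>lborel)"
  proof (rule nn_integral_cong)
    fix y :: real
    have "emeasure lborel ((\<lambda>x. (x, y)) -` A) = emeasure (distr lborel borel ((+) (\<beta> * y))) ((\<lambda>x. (x, y)) -` A)"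
      by (simp only: lborel_distr_plus)
    also have "\<dots> = emeasure lborel ((+) (\<beta> * y) -` ((\<lambda>x. (x, y)) -` A))"
      using sec by (simp add: emeasure_distr)
    also have "(+) (\<beta> * y) -` ((\<lambda>x. (x, y)) -` A) = (\<lambda>x. (x, y)) -` (?T -` A)"
      by (auto simp: add.commute)
    finally show "emeasure lborel ((\<lambda>x. (x, y)) -` (?T -` A)) = emeasure lborel ((\<lambda>x. (x, y)) -` A)" by simp
  qed
  also have "\<dots> = emeasure (lborel \<Otimes>\<^sub>M lborel) A"
    using A by (intro lborel_pair.emeasure_pair_measure_alt2[symmetric]) (simp only: lborel_prod sets_lborel)
  finally show "emeasure (distr lborel borel ?T) A = emeasure lborel A" by (simp add: lborel_prod)
qed simp

section \<open>Winding numbers as real integrals\<close>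

lemma AE_lborel_fst:
  assumes "AE x in lborel. P (x::real)"
  shows "AE z in lborel. P (fst (z::real \<times> real))"
proof -
  obtain N where N: "N \<in> null_sets lborel" "\<And>x. x \<in> space lborel - N \<Longrightarrow> P x"
    by (rule AE_E3[OF assms]) (rule that; assumption)
  have "N \<times> (UNIV::real set) \<in> null_sets (lborel \<Otimes>\<^sub>M lborel)"
    using N(1) by (auto simp: null_sets_def lborel.emeasure_pair_measure_Times)
  then have "N \<times> UNIV \<in> null_sets (lborel :: (real \<times> real) measure)" by (simp add: lborel_prod)
  moreover have "{z \<in> space lborel. \<not> P (fst z)} \<subseteq> N \<times> (UNIV :: real set)"
  proof
    fix z :: "real \<times> real" assume "z \<in> {z \<in> space lborel. \<not> P (fst z)}"
    then show "z \<in> N \<times> UNIV" using N(2)[of "fst z"] by (auto simp: mem_Times_iff)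
  qed
  ultimately show ?thesis by (rule AE_I')
qed

lemma AE_lborel_shear:
  assumes "AE x in lborel. P (x::real)"
  shows "AE z in lborel. P (fst z + \<beta> * snd (z::real \<times> real))"
proof -
  let ?T = "\<lambda>z::real \<times> real. (fst z + \<beta> * snd z, snd z)"
  have T: "?T \<in> measurable lborel borel"
    unfolding measurable_lborel2 by (intro borel_measurable_continuous_onI continuous_intros)
  have "AE z in distr lborel borel ?T. P (fst z)"
    unfolding lborel_shear by (rule AE_lborel_fst[OF assms])
  from AE_distrD[OF T this] show ?thesis by simp
qed

lemma contour_AE_vector_derivative:
  assumes "piecewise_C1_path \<gamma>"
  shows "AE t in lborel. t \<in> {0..1} \<longrightarrow>
    (\<gamma> has_vector_derivative vector_derivative \<gamma> (at t within {0..1})) (at t)"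
proof -
  obtain B where B: "finite B" "{0, 1} \<subseteq> B" "\<And>t. t \<in> {0..1} - B \<Longrightarrow> \<gamma> differentiable (at t)"
    by (rule piecewise_C1_path_derivative[OF assms]) blast
  have "AE t in lborel. t \<notin> B"
    using B(1) by (intro AE_not_in) (simp add: finite_imp_null_set_lborel)
  then show ?thesis
  proof eventually_elim
    case (elim t)
    show ?case
    proof
      assume t: "t \<in> {0..1}"
      then have "0 < t" "t < 1" using elim B(2) by (auto simp: less_le)
      moreover have "\<gamma> differentiable (at t)" using B(3) t elim by blast
      ultimately show "(\<gamma> has_vector_derivative vector_derivative \<gamma> (at t within {0..1})) (at t)"
        by (simp add: at_within_Icc_at vector_derivative_works)
    qed
  qed
qed

text \<open>A coordinate of the contour has a bounded Borel derivative that agrees almost everywhere with the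
  coordinate of \<^const>\<open>vector_derivative\<close> used in the line integrals.\<close>

lemma path_functional_derivative:
  fixes A :: "real \<times> real \<Rightarrow> real"
  assumes \<gamma>: "piecewise_C1_path \<gamma>" and A: "bounded_linear A"
  obtains K d where "K-lipschitz_on {0..1} (\<lambda>t. A (\<gamma> t))"
    "d \<in> borel_measurable borel" "\<And>t. \<bar>d t\<bar> \<le> K"
    "AE t in lborel. t \<in> {0..1} \<longrightarrow> 0 < t \<and> t < 1 \<and> ((\<lambda>t. A (\<gamma> t)) has_real_derivative d t) (at t)
       \<and> A (vector_derivative \<gamma> (at t within {0..1})) = d t"
    "(d has_integral (A (\<gamma> 1) - A (\<gamma> 0))) {0..1}"
proof -
  obtain L where L: "L-lipschitz_on {0..1} \<gamma>" by (rule piecewise_C1_path_lipschitz[OF \<gamma>])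
  obtain J where J: "0 < J" "\<And>x. norm (A x) \<le> norm x * J"
    using bounded_linear.pos_bounded[OF A] by blast
  have lip: "(J * L)-lipschitz_on {0..1} (\<lambda>t. A (\<gamma> t))"
  proof (rule lipschitz_onI)
    fix s t :: real assume st: "s \<in> {0..1}" "t \<in> {0..1}"
    have "dist (A (\<gamma> s)) (A (\<gamma> t)) \<le> J * dist (\<gamma> s) (\<gamma> t)"
      using J(2)[of "\<gamma> s - \<gamma> t"] by (simp add: dist_norm linear_diff[OF bounded_linear.linear[OF A]] mult.commute)
    also have "\<dots> \<le> J * (L * dist s t)" using J(1) lipschitz_onD[OF L st] by (intro mult_left_mono) auto
    finally show "dist (A (\<gamma> s)) (A (\<gamma> t)) \<le> J * L * dist s t" by (simp add: mult.assoc)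
  qed (use J lipschitz_on_nonneg[OF L] in simp)
  obtain d where d: "d \<in> borel_measurable borel" "\<And>t. \<bar>d t\<bar> \<le> J * L"
    "AE t in lborel. t \<in> {0..1} \<longrightarrow> 0 < t \<and> t < 1 \<and> ((\<lambda>t. A (\<gamma> t)) has_real_derivative d t) (at t)"
    "(d has_integral (A (\<gamma> 1) - A (\<gamma> 0))) {0..1}"
    by (rule lipschitz_interval_derivative[OF lip]) (simp, blast)
  have "AE t in lborel. t \<in> {0..1} \<longrightarrow> 0 < t \<and> t < 1 \<and> ((\<lambda>t. A (\<gamma> t)) has_real_derivative d t) (at t)
       \<and> A (vector_derivative \<gamma> (at t within {0..1})) = d t"
    using d(3) contour_AE_vector_derivative[OF \<gamma>]
  proof eventually_elim
    case (elim t)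
    show ?case
    proof
      assume t: "t \<in> {0..1}"
      have "((\<lambda>t. A (\<gamma> t)) has_real_derivative A (vector_derivative \<gamma> (at t within {0..1}))) (at t)"
        using bounded_linear.has_vector_derivative[OF A, of \<gamma>] elim t
        by (simp add: has_real_derivative_iff_has_vector_derivative)
      then show "0 < t \<and> t < 1 \<and> ((\<lambda>t. A (\<gamma> t)) has_real_derivative d t) (at t)
          \<and> A (vector_derivative \<gamma> (at t within {0..1})) = d t"
        using elim t by (auto intro: DERIV_unique)
    qed
  qed
  then show ?thesis using that[OF lip d(1,2) _ d(4)] by blast
qed

text \<open>The imaginary part of \<open>dc / (c - z)\<close>, written out in real coordinates. The integrand is bounded
  because \<open>z\<close> has positive distance from the compact path, so the gauge integral in the definition
  of contour integrals is a Lebesgue integral.\<close>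

lemma winding_number_real_integral:
  fixes X Y X' Y' :: "real \<Rightarrow> real"
  assumes c: "valid_path c" and z: "z \<notin> path_image c"
    and cXY: "\<And>t. t \<in> {0..1} \<Longrightarrow> c t = Complex (X t) (Y t)"
    and [measurable]: "X \<in> borel_measurable borel" "Y \<in> borel_measurable borel"
      "X' \<in> borel_measurable borel" "Y' \<in> borel_measurable borel"
    and D: "\<And>t. \<bar>X' t\<bar> \<le> D" "\<And>t. \<bar>Y' t\<bar> \<le> D"
    and der: "AE t in lborel. t \<in> {0..1} \<longrightarrow> 0 < t \<and> t < 1 \<and>
      (X has_real_derivative X' t) (at t) \<and> (Y has_real_derivative Y' t) (at t)"
  shows "(LINT t:{0..1}|lborel.
        Y' t * ((X t - Re z) / ((X t - Re z)\<^sup>2 + (Y t - Im z)\<^sup>2))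
        - X' t * ((Y t - Im z) / ((X t - Re z)\<^sup>2 + (Y t - Im z)\<^sup>2))) = 2 * pi * Re (winding_number c z)"
    (is "(LINT t:{0..1}|lborel. ?k t) = _")
proof -
  have D0: "D \<ge> 0" using D(1)[of 0] by simp
  have Im_kernel: "Im (1 / Complex x y * Complex p q) = q * (x / (x\<^sup>2 + y\<^sup>2)) - p * (y / (x\<^sup>2 + y\<^sup>2))"
    for x y p q by (simp add: Im_divide diff_divide_distrib)
  define I where "I = contour_integral c (\<lambda>w. 1 / (w - z))"
  have "(\<lambda>w. 1 / (w - z)) contour_integrable_on c"
    by (rule contour_integrable_inversediff[OF c z])
  then have "((\<lambda>w. 1 / (w - z)) has_contour_integral I) c"
    unfolding I_def by (rule has_contour_integral_integral)
  then have "((\<lambda>t. 1 / (c t - z) * vector_derivative c (at t within {0..1})) has_integral I) {0..1}"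
    by (simp only: has_contour_integral_def)
  from has_integral_linear[OF this bounded_linear_Im]
  have int: "((\<lambda>t. Im (1 / (c t - z) * vector_derivative c (at t within {0..1}))) has_integral Im I) {0..1}"
    by (simp only: comp_def)
  obtain N where N: "N \<in> null_sets lborel" and N': "\<And>t. t \<in> space lborel - N \<Longrightarrow> t \<in> {0..1} \<longrightarrow> 0 < t \<and> t < 1 \<and>
      (X has_real_derivative X' t) (at t) \<and> (Y has_real_derivative Y' t) (at t)"
    by (rule AE_E3[OF der]) (rule that; assumption)
  have "(?k has_integral Im I) {0..1}"
  proof (rule has_integral_spike[OF _ _ int])
    show "negligible N" using N by (simp add: negligible_iff_null_sets null_sets_completionI)
    fix t assume t: "t \<in> {0..1} - N"
    then have t': "0 < t" "t < 1" "(X has_real_derivative X' t) (at t)" "(Y has_real_derivative Y' t) (at t)"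
      using N' by auto
    have "((\<lambda>t. complex_of_real (X t) + \<i> * complex_of_real (Y t)) has_vector_derivative
        complex_of_real (X' t) + \<i> * complex_of_real (Y' t)) (at t)"
      using t'(3,4)
      by (intro has_vector_derivative_add has_vector_derivative_mult_right has_vector_derivative_of_real)
    then have "((\<lambda>t. Complex (X t) (Y t)) has_vector_derivative Complex (X' t) (Y' t)) (at t)"
      by (simp only: Complex_eq)
    then have "(c has_vector_derivative Complex (X' t) (Y' t)) (at t)"
      by (rule has_vector_derivative_transform_within_open[of _ _ _ "{0<..<1}"])
        (use t' cXY in auto)
    then have "vector_derivative c (at t within {0..1}) = Complex (X' t) (Y' t)"
      using t' by (simp add: at_within_Icc_at vector_derivative_at)
    moreover have "c t - z = Complex (X t - Re z) (Y t - Im z)"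
      using t cXY by (simp add: complex_eq_iff)
    ultimately show "?k t = Im (1 / (c t - z) * vector_derivative c (at t within {0..1}))"
      by (simp only: Im_kernel)
  qed
  moreover have "(LINT t:{0..1}|lborel. ?k t) = integral {0..1} ?k"
  proof (rule set_borel_integral_eq_integral(2))
    have "open (- path_image c)" using closed_valid_path_image[OF c] by auto
    then obtain r where r: "r > 0" "ball z r \<subseteq> - path_image c"
      using z by (meson ComplI openE)
    show "set_integrable lborel {0..1} ?k"
    proof (rule set_integrable_bounded_interval[where C = "D * (1 / r) + D * (1 / r)"])
      fix t :: real assume t: "t \<in> {0..1}"
      define v where "v = c t - z"
      have "c t \<in> path_image c" using t by (auto simp: path_image_def)
      then have vr: "norm v \<ge> r" using r(2) by (force simp: v_def dist_norm norm_minus_commute)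
      have v: "X t - Re z = Re v" "Y t - Im z = Im v" using cXY[OF t] by (auto simp: v_def)
      have n: "(Re v)\<^sup>2 + (Im v)\<^sup>2 = (norm v)\<^sup>2" by (simp add: cmod_power2)
      have bound: "\<bar>s / (norm v)\<^sup>2\<bar> \<le> 1 / r" if "\<bar>s\<bar> \<le> norm v" for s
      proof -
        have "\<bar>s / (norm v)\<^sup>2\<bar> \<le> norm v / (norm v)\<^sup>2"
          using that by (simp add: divide_right_mono)
        also have "\<dots> = 1 / norm v" using vr r(1) by (simp add: power2_eq_square)
        also have "\<dots> \<le> 1 / r" using vr r(1) by (simp add: frac_le)
        finally show ?thesis .
      qed
      have "\<bar>Y' t * (Re v / (norm v)\<^sup>2)\<bar> \<le> D * (1 / r)"
        unfolding abs_mult by (intro mult_mono D D0 bound abs_Re_le_cmod abs_ge_zero)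
      moreover have "\<bar>X' t * (Im v / (norm v)\<^sup>2)\<bar> \<le> D * (1 / r)"
        unfolding abs_mult by (intro mult_mono D D0 bound abs_Im_le_cmod abs_ge_zero)
      ultimately show "\<bar>?k t\<bar> \<le> D * (1 / r) + D * (1 / r)"
        unfolding v n by linarith
    qed measurable
  qed
  ultimately have "(LINT t:{0..1}|lborel. ?k t) = Im I" by (simp add: integral_unique)
  then show ?thesis using Re_winding_number[OF c z] by (simp add: I_def)
qed

section \<open>Green's theorem for Lipschitz integrands\<close>

text \<open>By the Jordan curve theorem the winding number is constant, \<open>1\<close> or \<open>- 1\<close>, on the inside, and the
  sign in \<^const>\<open>area_form_integral\<close> is chosen to be that constant.\<close>

lemma contour_winding_number:
  fixes \<gamma> :: "real \<Rightarrow> real \<times> real"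
  assumes \<gamma>: "simple_closed_contour \<gamma>" and z: "z \<notin> path_image \<gamma>"
  shows "winding_number (\<lambda>t. Complex (fst (\<gamma> t)) (snd (\<gamma> t))) (Complex (fst z) (snd z))
    = of_real ((if counter_clockwise \<gamma> then 1 else - 1) * indicator (inside (path_image \<gamma>)) z)"
proof -
  define F where "F = (\<lambda>z. Complex (fst z) (snd z))"
  define G where "G = (\<lambda>w. (Re w, Im w))"
  have F: "bounded_linear F" using bounded_linear_Complex[of 0] by (simp add: F_def)
  have G: "bounded_linear G" unfolding G_def by (intro bounded_linear_Pair bounded_linear_Re bounded_linear_Im)
  have GF: "G (F x) = x" and FG: "F (G y) = y" for x y by (simp_all add: F_def G_def)
  have injF: "inj F" using GF by (metis injI)
  have sp: "simple_path \<gamma>" and closed: "pathfinish \<gamma> = pathstart \<gamma>"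
    using \<gamma> by (auto simp: simple_closed_contour_def)
  have spF: "simple_path (F \<circ> \<gamma>)"
    using sp simple_path_linear_image_eq[OF bounded_linear.linear[OF F] injF] by simp
  have im: "path_image (F \<circ> \<gamma>) = F ` path_image \<gamma>" by (rule path_image_compose)
  have ins: "inside (path_image (F \<circ> \<gamma>)) = F ` inside (path_image \<gamma>)"
    unfolding im by (rule inside_linear_image[OF F G GF FG])
  have cc: "counter_clockwise \<gamma> \<longleftrightarrow> (\<forall>z \<in> inside (path_image \<gamma>). winding_number (F \<circ> \<gamma>) (F z) = 1)"
    by (auto simp: counter_clockwise_def F_def comp_def)
  have "winding_number (F \<circ> \<gamma>) (F z)
      = of_real ((if counter_clockwise \<gamma> then 1 else - 1) * indicator (inside (path_image \<gamma>)) z)"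
  proof (cases "z \<in> inside (path_image \<gamma>)")
    case True
    then have Fz: "F z \<in> inside (path_image (F \<circ> \<gamma>))" by (simp add: ins)
    show ?thesis
    proof (rule simple_closed_path_winding_number_inside[OF spF])
      assume "\<And>w. w \<in> inside (path_image (F \<circ> \<gamma>)) \<Longrightarrow> winding_number (F \<circ> \<gamma>) w = 1"
      then show ?thesis using True Fz by (simp add: cc ins)
    next
      assume *: "\<And>w. w \<in> inside (path_image (F \<circ> \<gamma>)) \<Longrightarrow> winding_number (F \<circ> \<gamma>) w = - 1"
      then have "\<not> counter_clockwise \<gamma>" using True Fz unfolding cc by force
      then show ?thesis using *[OF Fz] True by simp
    qed
  next
    case False
    have "F z \<notin> inside (path_image (F \<circ> \<gamma>))" "F z \<notin> path_image (F \<circ> \<gamma>)"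
      unfolding ins unfolding im using False z by (simp_all add: inj_image_mem_iff[OF injF])
    then have "F z \<in> outside (path_image (F \<circ> \<gamma>))" using inside_Un_outside[of "path_image (F \<circ> \<gamma>)"] by blast
    moreover have "pathfinish (F \<circ> \<gamma>) = pathstart (F \<circ> \<gamma>)"
      using closed by (simp add: pathfinish_compose pathstart_compose)
    ultimately have "winding_number (F \<circ> \<gamma>) (F z) = 0"
      using spF by (intro winding_number_zero_in_outside) (auto simp: simple_path_imp_path)
    then show ?thesis using False by simp
  qed
  then show ?thesis by (simp add: F_def comp_def)
qed

lemma negligible_piecewise_C1_image:
  fixes A :: "real \<times> real \<Rightarrow> real \<times> real"
  assumes \<gamma>: "piecewise_C1_path \<gamma>" and A: "bounded_linear A"
  shows "negligible (A ` path_image \<gamma>)"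
proof -
  obtain B where B: "finite B" "{0, 1} \<subseteq> B" "\<And>t. t \<in> {0..1} - B \<Longrightarrow> \<gamma> differentiable (at t)"
    by (rule piecewise_C1_path_derivative[OF \<gamma>]) blast
  have "negligible ((\<lambda>t. A (\<gamma> t)) ` ({0..1} - B))"
  proof (rule negligible_differentiable_image_lowdim)
    show "(\<lambda>t. A (\<gamma> t)) differentiable_on ({0..1} - B)"
      unfolding differentiable_on_def
    proof
      fix t assume "t \<in> {0..1} - B"
      then have "\<gamma> differentiable (at t)" by (rule B(3))
      then have "(A \<circ> \<gamma>) differentiable (at t)"
        by (rule differentiable_chain_at) (rule bounded_linear_imp_differentiable[OF A])
      then show "(\<lambda>t. A (\<gamma> t)) differentiable (at t within {0..1} - B)"
        by (auto simp: comp_def intro: differentiable_at_withinI)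
    qed
  qed simp
  moreover have "negligible ((\<lambda>t. A (\<gamma> t)) ` B)" using B(1) by (intro negligible_finite) simp
  ultimately have "negligible ((\<lambda>t. A (\<gamma> t)) ` ({0..1} - B) \<union> (\<lambda>t. A (\<gamma> t)) ` B)" by (rule negligible_Un)
  then show ?thesis by (rule negligible_subset) (auto simp: path_image_def)
qed

lemma integral_lborel_shear:
  fixes F :: "real \<times> real \<Rightarrow> real"
  assumes F: "F \<in> borel_measurable borel"
  shows "(LINT z|lborel. F z) = (LINT z|lborel. F (fst z + \<beta> * snd z, snd z))"
proof -
  let ?T = "\<lambda>z::real \<times> real. (fst z + \<beta> * snd z, snd z)"
  have T: "?T \<in> measurable lborel borel"
    unfolding measurable_lborel2 by (intro borel_measurable_continuous_onI continuous_intros)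
  have "(LINT z|lborel. F z) = (LINT z|distr lborel borel ?T. F z)" by (simp only: lborel_shear)
  also have "\<dots> = (LINT z|lborel. F (?T z))" by (rule integral_distr[OF T F])
  finally show ?thesis .
qed

text \<open>\<open>integral_winding_kernel\<close> is applied to the sheared contour \<open>(q + \<beta> p, p)\<close>. Its winding number
  about \<open>z\<close> is that of the original contour about the preimage of \<open>z\<close> under the shear, and so it is
  \<open>\<plusminus>1\<close> on the sheared inside and \<open>0\<close> elsewhere, apart from the null set covered by the curve itself.
  Undoing the shear in the area integral then gives the claim.\<close>

lemma green_lipschitz:
  fixes \<gamma> :: "real \<Rightarrow> real \<times> real" and g :: "real \<Rightarrow> real"
  assumes \<gamma>: "simple_closed_contour \<gamma>" and g: "K-lipschitz_on UNIV g"
  shows "set_integrable lebesgue (inside (path_image \<gamma>)) (\<lambda>z. deriv g (fst z + \<beta> * snd z))"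
    and "line_integral_dp \<gamma> (\<lambda>z. g (fst z + \<beta> * snd z))
       = area_form_integral \<gamma> (\<lambda>z. deriv g (fst z + \<beta> * snd z))"
proof -
  define \<Gamma> where "\<Gamma> = inside (path_image \<gamma>)"
  define u where "u = (\<lambda>z. fst z + \<beta> * snd z)"
  define \<sigma> :: real where "\<sigma> = (if counter_clockwise \<gamma> then 1 else - 1)"
  have u: "bounded_linear u"
    unfolding u_def by (intro bounded_linear_add bounded_linear_fst bounded_linear_snd
        bounded_linear_compose[OF bounded_linear_mult_right])
  have sp: "simple_path \<gamma>" and closed: "\<gamma> 1 = \<gamma> 0" and pc: "piecewise_C1_path \<gamma>"
    using \<gamma> by (auto simp: simple_closed_contour_def pathfinish_def pathstart_def)
  have path: "path \<gamma>" using sp by (rule simple_path_imp_path)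
  have open\<Gamma>: "open \<Gamma>" unfolding \<Gamma>_def by (intro open_inside closed_path_image path)
  have bdd\<Gamma>: "bounded \<Gamma>" unfolding \<Gamma>_def by (intro bounded_inside bounded_path_image path)
  have [measurable]: "\<Gamma> \<in> sets borel" using open\<Gamma> by simp
  obtain h where h [measurable]: "h \<in> borel_measurable borel" and hK: "\<And>x. \<bar>h x\<bar> \<le> K"
    and gh: "AE x in lborel. (g has_real_derivative h x) (at x)"
    and g_int: "\<And>a b. a \<le> b \<Longrightarrow> (h has_integral (g b - g a)) {a..b}"
    by (rule lipschitz_derivative[OF g]) blast
  have g_cont: "continuous_on UNIV g" using g by (rule lipschitz_on_continuous_on)
  then have [measurable]: "g \<in> borel_measurable borel" by (rule borel_measurable_continuous_onI)
  have hu [measurable]: "(\<lambda>z. h (u z)) \<in> borel_measurable borel" unfolding u_def by measurable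
  have dg: "AE z in lborel. deriv g (u z) = h (u z)"
  proof -
    have "AE x in lborel. deriv g x = h x"
      using gh by eventually_elim (rule DERIV_imp_deriv)
    then show ?thesis unfolding u_def by (rule AE_lborel_shear)
  qed
  have ae\<Gamma>: "AE z in lborel. indicator \<Gamma> z *\<^sub>R deriv g (u z) = indicator \<Gamma> z *\<^sub>R h (u z)"
    using dg by eventually_elim simp
  have area: "(LINT z:\<Gamma>|lebesgue. deriv g (u z)) = (LINT z|lborel. indicator \<Gamma> z *\<^sub>R h (u z))"
    unfolding set_lebesgue_integral_def by (rule integral_lebesgue_AE_eq[OF _ ae\<Gamma>]) measurable
  have "integrable lborel (\<lambda>z. indicator \<Gamma> z *\<^sub>R h (u z))"
    by (rule integrableI_bounded_set_indicator[where B = K])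
      (use hK emeasure_bounded_finite[OF bdd\<Gamma>] in auto)
  then have int_h: "integrable lebesgue (\<lambda>z. indicator \<Gamma> z *\<^sub>R h (u z))"
    by (subst integrable_completion) measurable
  have "integrable lebesgue (\<lambda>z. indicator \<Gamma> z *\<^sub>R deriv g (u z))"
  proof (rule integrable_cong_AE_imp[OF int_h])
    show "(\<lambda>z. indicator \<Gamma> z *\<^sub>R deriv g (u z)) \<in> borel_measurable lebesgue"
      by (rule borel_measurable_lebesgue_AE_eq[OF borel_measurable_integrable[OF int_h] ae\<Gamma>])
    show "AE z in lebesgue. indicator \<Gamma> z *\<^sub>R h (u z) = indicator \<Gamma> z *\<^sub>R deriv g (u z)"
      using AE_completion[OF ae\<Gamma>] by eventually_elim (rule sym)
  qed
  then show "set_integrable lebesgue (inside (path_image \<gamma>)) (\<lambda>z. deriv g (fst z + \<beta> * snd z))"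
    by (simp add: set_integrable_def \<Gamma>_def u_def)

  obtain K1 X' where X': "K1-lipschitz_on {0..1} (\<lambda>t. u (\<gamma> t))" "X' \<in> borel_measurable borel"
    "\<And>t. \<bar>X' t\<bar> \<le> K1"
    "AE t in lborel. t \<in> {0..1} \<longrightarrow> 0 < t \<and> t < 1 \<and> ((\<lambda>t. u (\<gamma> t)) has_real_derivative X' t) (at t)
       \<and> u (vector_derivative \<gamma> (at t within {0..1})) = X' t"
    by (rule path_functional_derivative[OF pc u]) blast
  obtain K2 Y' where Y': "K2-lipschitz_on {0..1} (\<lambda>t. snd (\<gamma> t))" "Y' \<in> borel_measurable borel"
    "\<And>t. \<bar>Y' t\<bar> \<le> K2"
    "AE t in lborel. t \<in> {0..1} \<longrightarrow> 0 < t \<and> t < 1 \<and> ((\<lambda>t. snd (\<gamma> t)) has_real_derivative Y' t) (at t)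
       \<and> snd (vector_derivative \<gamma> (at t within {0..1})) = Y' t"
    "(Y' has_integral (snd (\<gamma> 1) - snd (\<gamma> 0))) {0..1}"
    by (rule path_functional_derivative[OF pc bounded_linear_snd]) blast
  note [measurable] = X'(2) Y'(2)
  define X where "X = (\<lambda>t. u (\<gamma> (max 0 (min 1 t))))"
  define Y where "Y = (\<lambda>t. snd (\<gamma> (max 0 (min 1 t))))"
  have X_eq: "X t = u (\<gamma> t)" and Y_eq: "Y t = snd (\<gamma> t)" if "t \<in> {0..1}" for t
    using that by (auto simp: X_def Y_def)
  have [measurable]: "X \<in> borel_measurable borel"
    using lipschitz_on_continuous_on[OF clamp_lipschitz[OF X'(1)]]
    unfolding X_def by (intro borel_measurable_continuous_onI) simp
  have [measurable]: "Y \<in> borel_measurable borel"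
    using lipschitz_on_continuous_on[OF clamp_lipschitz[OF Y'(1)]]
    unfolding Y_def by (intro borel_measurable_continuous_onI) simp
  have XY_der: "AE t in lborel. t \<in> {0..1} \<longrightarrow> 0 < t \<and> t < 1 \<and>
      (X has_real_derivative X' t) (at t) \<and> (Y has_real_derivative Y' t) (at t)"
    using X'(4) Y'(4)
  proof eventually_elim
    case (elim t)
    show ?case
    proof
      assume "t \<in> {0..1}"
      then have t: "0 < t" "t < 1" "((\<lambda>t. u (\<gamma> t)) has_real_derivative X' t) (at t)"
        "((\<lambda>t. snd (\<gamma> t)) has_real_derivative Y' t) (at t)" using elim by auto
      have "(X has_real_derivative X' t) (at t)"
        by (rule has_field_derivative_transform_within_open[OF t(3), of "{0<..<1}"]) (use t X_eq in auto)
      moreover have "(Y has_real_derivative Y' t) (at t)"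
        by (rule has_field_derivative_transform_within_open[OF t(4), of "{0<..<1}"]) (use t Y_eq in auto)
      ultimately show "0 < t \<and> t < 1 \<and> (X has_real_derivative X' t) (at t) \<and> (Y has_real_derivative Y' t) (at t)"
        using t by simp
    qed
  qed

  define S where "S = (\<lambda>z. (u z, snd z))"
  have S: "bounded_linear S" unfolding S_def by (intro bounded_linear_Pair u bounded_linear_snd)
  have "bounded (S ` (path_image \<gamma> \<union> \<Gamma>))"
    by (intro bounded_linear_image[OF _ S]) (simp add: bdd\<Gamma> bounded_path_image path)
  then obtain M where M: "\<forall>z \<in> S ` (path_image \<gamma> \<union> \<Gamma>). norm z \<le> M" unfolding bounded_iff by blast
  have box: "\<bar>u z\<bar> \<le> M \<and> \<bar>snd z\<bar> \<le> M" if "z \<in> path_image \<gamma> \<union> \<Gamma>" for z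
    using M that norm_fst_le[of "u z" "snd z"] norm_snd_le[of "snd z" "u z"]
    by (force simp: S_def)
  have \<gamma>_clamp: "\<gamma> (max 0 (min 1 t)) \<in> path_image \<gamma>" for t by (auto simp: path_image_def)
  \<comment> \<open>The winding number of the sheared contour.\<close>
  define w where "w = (\<lambda>z. \<sigma> * indicator \<Gamma> (fst z - \<beta> * snd z, snd z))"
  have [measurable]: "(\<lambda>z. (fst z - \<beta> * snd z, snd z)) \<in> borel_measurable (borel :: (real \<times> real) measure)"
    by (intro borel_measurable_continuous_onI continuous_intros)
  have w_meas [measurable]: "w \<in> borel_measurable borel" unfolding w_def by measurable
  have w0: "w z = 0" if "z \<notin> {-M..M} \<times> {-M..M}" for z
  proof -
    have "(fst z - \<beta> * snd z, snd z) \<notin> \<Gamma>"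
      using box[of "(fst z - \<beta> * snd z, snd z)"] that by (auto simp: u_def mem_Times_iff abs_le_iff)
    then show ?thesis by (simp add: w_def)
  qed

  define c where "c = (\<lambda>t. Complex (u (\<gamma> t)) (snd (\<gamma> t)))"
  have c: "valid_path c"
    unfolding c_def u_def by (rule valid_path_linear_image[OF pc bounded_linear_Complex])
  have "AE z in lebesgue. z \<notin> S ` path_image \<gamma>"
    using negligible_piecewise_C1_image[OF pc S] by (intro AE_not_in) (simp add: negligible_iff_null_sets)
  then have "AE z in lborel. z \<notin> S ` path_image \<gamma>" by (simp only: AE_completion_iff)
  then have w_wind: "AE z in lborel. (LINT t:{0..1}|lborel.
        Y' t * ((X t - fst z) / ((X t - fst z)\<^sup>2 + (Y t - snd z)\<^sup>2))
        - X' t * ((Y t - snd z) / ((X t - fst z)\<^sup>2 + (Y t - snd z)\<^sup>2))) = 2 * pi * w z"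
  proof eventually_elim
    case (elim z)
    define z0 where "z0 = (fst z - \<beta> * snd z, snd z)"
    define c0 where "c0 = (\<lambda>t. Complex (fst (\<gamma> t)) (snd (\<gamma> t)))"
    define \<zeta> where "\<zeta> = Complex (fst z) (snd z)"
    have Sz: "S z0 = z" by (simp add: S_def z0_def u_def)
    then have z0: "z0 \<notin> path_image \<gamma>" using elim by (metis imageI)
    have \<zeta>: "\<zeta> \<notin> path_image c"
    proof
      assume "\<zeta> \<in> path_image c"
      then obtain t where "t \<in> {0..1}" "\<zeta> = c t" by (auto simp: path_image_def)
      then have "z = S (\<gamma> t)" by (simp add: \<zeta>_def c_def S_def prod_eq_iff)
      then show False using elim \<open>t \<in> {0..1}\<close> by (auto simp: path_image_def)
    qed
    have z0c: "Complex (fst z0) (snd z0) \<notin> path_image c0"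
      using z0 by (auto simp: path_image_def c0_def prod_eq_iff image_iff)
    have "valid_path c0"
      using valid_path_linear_image[OF pc bounded_linear_Complex[of 0]] by (simp add: c0_def)
    then have "winding_number (\<lambda>t. Complex (Re (c0 t) + \<beta> * Im (c0 t)) (Im (c0 t)))
        (Complex (fst z0 + \<beta> * snd z0) (snd z0)) = winding_number c0 (Complex (fst z0) (snd z0))"
      using winding_number_shear[OF valid_path_imp_path _ z0c] closed
      by (simp add: c0_def pathfinish_def pathstart_def)
    then have "winding_number c \<zeta> = winding_number c0 (Complex (fst z0) (snd z0))"
      by (simp add: c_def c0_def u_def z0_def \<zeta>_def)
    also have "\<dots> = of_real (w z)"
      unfolding c0_def by (subst contour_winding_number[OF \<gamma> z0]) (simp add: w_def z0_def \<sigma>_def \<Gamma>_def)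
    finally have "Re (winding_number c \<zeta>) = w z" by simp
    moreover have "(LINT t:{0..1}|lborel.
        Y' t * ((X t - Re \<zeta>) / ((X t - Re \<zeta>)\<^sup>2 + (Y t - Im \<zeta>)\<^sup>2))
        - X' t * ((Y t - Im \<zeta>) / ((X t - Re \<zeta>)\<^sup>2 + (Y t - Im \<zeta>)\<^sup>2))) = 2 * pi * Re (winding_number c \<zeta>)"
    proof (rule winding_number_real_integral[where D = "max K1 K2"])
      show "c t = Complex (X t) (Y t)" if "t \<in> {0..1}" for t using that by (simp add: c_def X_eq Y_eq)
      show "\<bar>X' t\<bar> \<le> max K1 K2" "\<bar>Y' t\<bar> \<le> max K1 K2" for t
        using X'(3)[of t] Y'(3)[of t] by auto
    qed (use c \<zeta> XY_der in measurable)
    ultimately show ?case by (simp add: \<zeta>_def)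
  qed

  have core: "(LINT z|lborel. w z * h (fst z)) = (LINT t:{0..1}|lborel. g (X t) * Y' t)"
  proof (rule integral_winding_kernel[where X = X and Y = Y and X' = X' and g = g and M = M
        and D = "max K1 K2" and C = K])
    show "\<bar>X t\<bar> \<le> M" "\<bar>Y t\<bar> \<le> M" for t
      using box[of "\<gamma> (max 0 (min 1 t))"] \<gamma>_clamp[of t] by (auto simp: X_def Y_def)
    show "\<bar>X' t\<bar> \<le> max K1 K2" "\<bar>Y' t\<bar> \<le> max K1 K2" for t
      using X'(3)[of t] Y'(3)[of t] by auto
    have "(LINT t:{0..1}|lborel. Y' t) = integral {0..1} Y'"
      by (intro set_borel_integral_eq_integral set_integrable_bounded_interval[where C = K2] Y')
    then show "(LINT t:{0..1}|lborel. Y' t) = 0" using Y'(5) closed by (simp add: integral_unique)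
  qed (use w_meas hK g_int g_cont w0 w_wind in \<open>measurable\<close>)
  have "(LINT z|lborel. w z * h (fst z)) = \<sigma> * (LINT z|lborel. indicator \<Gamma> z *\<^sub>R h (u z))"
    by (subst integral_lborel_shear[where \<beta> = \<beta>]) (measurable, simp add: w_def u_def mult.assoc)
  also have "\<dots> = area_form_integral \<gamma> (\<lambda>z. deriv g (u z))"
    unfolding area[symmetric] unfolding area_form_integral_def \<Gamma>_def \<sigma>_def by (rule refl)
  finally have area_form: "(LINT z|lborel. w z * h (fst z)) = area_form_integral \<gamma> (\<lambda>z. deriv g (u z))" .
  have line: "(LINT t:{0..1}|lborel. g (X t) * Y' t) = line_integral_dp \<gamma> (\<lambda>z. g (u z))"
    unfolding line_integral_dp_def set_lebesgue_integral_def
  proof (rule integral_lebesgue_AE_eq[symmetric])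
    show "AE t in lborel. indicat_real {0..1} t *\<^sub>R (g (u (\<gamma> t)) * snd (vector_derivative \<gamma> (at t within {0..1})))
        = indicat_real {0..1} t *\<^sub>R (g (X t) * Y' t)"
      using Y'(4) by eventually_elim (auto simp: indicator_def X_eq)
  qed measurable
  show "line_integral_dp \<gamma> (\<lambda>z. g (fst z + \<beta> * snd z))
       = area_form_integral \<gamma> (\<lambda>z. deriv g (fst z + \<beta> * snd z))"
    using core unfolding area_form line by (simp add: u_def)
qed

section \<open>Loop integrals of the discrete dynamics\<close>

abbreviation lipschitz_unit :: "(real \<Rightarrow> real) \<Rightarrow> bool" where
  "lipschitz_unit u \<equiv> \<exists>C. C-lipschitz_on {0..1} u"

lemma lipschitz_unit_add: "lipschitz_unit u \<Longrightarrow> lipschitz_unit v \<Longrightarrow> lipschitz_unit (\<lambda>t. u t + v t)"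
  using lipschitz_on_add by blast

lemma lipschitz_unit_diff: "lipschitz_unit u \<Longrightarrow> lipschitz_unit v \<Longrightarrow> lipschitz_unit (\<lambda>t. u t - v t)"
  using lipschitz_on_diff by blast

lemma lipschitz_unit_cmult: "lipschitz_unit u \<Longrightarrow> lipschitz_unit (\<lambda>t. a * u t)"
  using lipschitz_on_cmult_real by blast

lemma lipschitz_unit_compose:
  assumes "K-lipschitz_on UNIV g" "lipschitz_unit u"
  shows "lipschitz_unit (\<lambda>t. g (u t))"
  using assms lipschitz_on_compose2[of _ "{0..1}" u K g] lipschitz_on_mono[OF assms(1), of "u ` {0..1}" K]
  by blast

lemma lipschitz_unit_continuous: "lipschitz_unit u \<Longrightarrow> continuous_on {0..1} u"
  using lipschitz_on_continuous_on by blast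

lemma lipschitz_unit_C1_compose:
  assumes \<Phi>: "\<And>x. (\<Phi> has_real_derivative \<phi> x) (at x)" and \<phi>: "continuous_on UNIV \<phi>" and u: "lipschitz_unit u"
  shows "lipschitz_unit (\<lambda>t. \<Phi> (u t))"
proof -
  have "bounded (u ` {0..1})"
    by (intro compact_imp_bounded compact_continuous_image lipschitz_unit_continuous u) simp
  then obtain R where "\<forall>x \<in> u ` {0..1}. norm x \<le> R" unfolding bounded_iff by blast
  then have R: "u ` {0..1} \<subseteq> {-R..R}" by (auto simp: abs_le_iff)
  obtain K where K: "K-lipschitz_on {-R..R} \<Phi>"
  proof (rule C1_imp_lipschitz)
    show "continuous_on {-R..R} \<phi>" using \<phi> by (rule continuous_on_subset) simp
    show "(\<Phi> has_vector_derivative \<phi> x) (at x within {-R..R})" for x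
      using \<Phi>[of x] by (simp add: has_real_derivative_iff_has_vector_derivative has_vector_derivative_at_within)
  qed
  obtain C where "C-lipschitz_on {0..1} u" using u by blast
  then have "(K * C)-lipschitz_on {0..1} (\<lambda>t. \<Phi> (u t))"
    by (rule lipschitz_on_compose2) (rule lipschitz_on_mono[OF K R order_refl])
  then show ?thesis by blast
qed

text \<open>By polarization, from the case of squares.\<close>

lemma lipschitz_unit_mult:
  assumes u: "lipschitz_unit u" and v: "lipschitz_unit v"
  shows "lipschitz_unit (\<lambda>t. u t * v t)"
proof -
  have sq: "lipschitz_unit (\<lambda>t. (w t)\<^sup>2)" if "lipschitz_unit w" for w
    by (rule lipschitz_unit_C1_compose[where \<phi> = "\<lambda>x. 2 * x"])
      (auto intro!: derivative_eq_intros continuous_intros that)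
  have "lipschitz_unit (\<lambda>t. 1 / 4 * ((u t + v t)\<^sup>2 - (u t - v t)\<^sup>2))"
    by (intro lipschitz_unit_cmult lipschitz_unit_diff sq lipschitz_unit_add u v)
  moreover have "1 / 4 * ((x + y)\<^sup>2 - (x - y)\<^sup>2) = x * y" for x y :: real
    by (simp add: power2_eq_square algebra_simps)
  ultimately show ?thesis by simp
qed

text \<open>The line integrals have this form: a function that is continuous on the parameter interval only,
  times the bounded derivative of a coordinate.\<close>

lemma set_integrable_continuous_times_bounded:
  fixes F d :: "real \<Rightarrow> real"
  assumes F: "continuous_on {0..1} F" and d [measurable]: "d \<in> borel_measurable borel" and K: "\<And>t. \<bar>d t\<bar> \<le> K"
  shows "set_integrable lebesgue {0..1} (\<lambda>t. F t * d t)"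
proof -
  have Fm [measurable]: "(\<lambda>t. indicator {0..1} t *\<^sub>R F t) \<in> borel_measurable borel"
    by (rule borel_measurable_continuous_on_indicator[OF _ F]) simp
  have "bounded (F ` {0..1})" by (intro compact_imp_bounded compact_continuous_image F) simp
  then obtain R where "\<forall>x \<in> F ` {0..1}. norm x \<le> R" unfolding bounded_iff by blast
  then have R: "\<bar>F t\<bar> \<le> R" if "t \<in> {0..1}" for t using that by auto
  have "set_integrable lborel {0..1} (\<lambda>t. (indicator {0..1} t *\<^sub>R F t) * d t)"
  proof (rule set_integrable_bounded_interval)
    show "\<bar>(indicator {0..1} t *\<^sub>R F t) * d t\<bar> \<le> R * K" if t: "t \<in> {0..1}" for t
    proof -
      have "\<bar>F t\<bar> * \<bar>d t\<bar> \<le> R * K" by (rule mult_mono'[OF R[OF t] K]) auto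
      then show ?thesis using t by (simp add: abs_mult)
    qed
  qed measurable
  then have "integrable lborel (\<lambda>t. (indicator {0..1} t *\<^sub>R F t) * d t)"
    unfolding set_integrable_def
    by (rule Bochner_Integration.integrable_cong[THEN iffD1, rotated -1]) (auto simp: indicator_def)
  then have "integrable lebesgue (\<lambda>t. (indicator {0..1} t *\<^sub>R F t) * d t)"
    by (subst integrable_completion) measurable
  then show ?thesis unfolding set_integrable_def by (simp add: mult.assoc)
qed

lemma set_integral_lebesgue_AE_cong:
  fixes f h :: "real \<Rightarrow> real"
  assumes h: "set_integrable lebesgue A h" and eq: "AE t in lborel. t \<in> A \<longrightarrow> f t = h t"
  shows "(LINT t:A|lebesgue. f t) = (LINT t:A|lebesgue. h t)"
  unfolding set_lebesgue_integral_def
proof (rule integral_lebesgue_AE_cong)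
  show "(\<lambda>t. indicat_real A t *\<^sub>R h t) \<in> borel_measurable lebesgue"
    using h unfolding set_integrable_def by (rule borel_measurable_integrable)
  show "AE t in lborel. indicat_real A t *\<^sub>R f t = indicat_real A t *\<^sub>R h t"
    using eq by eventually_elim (auto simp: indicator_def)
qed

lemma loop_integral_derivative:
  fixes E E' :: "real \<Rightarrow> real"
  assumes "lipschitz_unit E" "E 1 = E 0"
    and "AE t in lborel. t \<in> {0..1} \<longrightarrow> (E has_real_derivative E' t) (at t)"
  shows "(LINT t:{0..1}|lebesgue. E' t) = 0"
  using assms lipschitz_integral_derivative[of _ 0 1 E E'] by auto

text \<open>The potential force enters through the exact differential \<open>f'(q) dq = df(q)\<close> and the second half
  of the step through \<open>P dP = d(P\<^sup>2 / 2)\<close>, so neither changes the area.\<close>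

lemma contour_area_psi:
  fixes f :: "real \<Rightarrow> real" and \<gamma> :: "real \<Rightarrow> real \<times> real"
  assumes L: "L > 0" and f: "\<And>x. (f has_real_derivative deriv f x) (at x)"
    and lip: "K-lipschitz_on UNIV (deriv f)"
    and \<gamma>: "piecewise_C1_path \<gamma>" and closed: "\<gamma> 1 = \<gamma> 0"
  shows "contour_area (psi f L \<kappa> T \<circ> \<gamma>) = line_integral_dp \<gamma> fst - T * line_integral_dq \<gamma> (f_NP f L \<kappa>)"
proof -
  define g where "g = deriv f"
  define q where "q = (\<lambda>t. fst (\<gamma> t))"
  define p where "p = (\<lambda>t. snd (\<gamma> t))"
  define N where "N = (\<lambda>t. f_NP f L \<kappa> (\<gamma> t))"
  define P where "P = (\<lambda>t. p t + T * (- (1 / L) * g (q t) + N t))"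
  define Q where "Q = (\<lambda>t. q t + T * P t)"
  have N_eq: "N = (\<lambda>t. - 2 * damp \<kappa> * p t - 1 / L * (g (q t + mom \<kappa> * p t) - g (q t)))"
    by (simp add: N_def f_NP_def p_def q_def g_def case_prod_beta)
  have psi_eq: "psi f L \<kappa> T \<circ> \<gamma> = (\<lambda>t. (Q t, P t))"
    by (auto simp: fun_eq_iff psi_def Let_def Q_def P_def N_def p_def q_def g_def case_prod_beta)
  obtain Kq q' where q': "Kq-lipschitz_on {0..1} q" "q' \<in> borel_measurable borel" "\<And>t. \<bar>q' t\<bar> \<le> Kq"
    "AE t in lborel. t \<in> {0..1} \<longrightarrow> 0 < t \<and> t < 1 \<and> (q has_real_derivative q' t) (at t)
       \<and> fst (vector_derivative \<gamma> (at t within {0..1})) = q' t"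
    unfolding q_def by (rule path_functional_derivative[OF \<gamma> bounded_linear_fst]) blast
  obtain Kp p' where p': "Kp-lipschitz_on {0..1} p" "p' \<in> borel_measurable borel" "\<And>t. \<bar>p' t\<bar> \<le> Kp"
    "AE t in lborel. t \<in> {0..1} \<longrightarrow> 0 < t \<and> t < 1 \<and> (p has_real_derivative p' t) (at t)
       \<and> snd (vector_derivative \<gamma> (at t within {0..1})) = p' t"
    unfolding p_def by (rule path_functional_derivative[OF \<gamma> bounded_linear_snd]) blast
  have lq: "lipschitz_unit q" and lp: "lipschitz_unit p" using q'(1) p'(1) by blast+
  have lg: "lipschitz_unit (\<lambda>t. g (u t))" if "lipschitz_unit u" for u
    unfolding g_def by (rule lipschitz_unit_compose[OF lip that])
  have lN: "lipschitz_unit N"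
    unfolding N_eq by (intro lipschitz_unit_diff lipschitz_unit_cmult lg lipschitz_unit_add lp lq)
  have lP: "lipschitz_unit P"
    unfolding P_def by (intro lipschitz_unit_add lipschitz_unit_cmult lg lN lp lq)
  have lQ: "lipschitz_unit Q"
    unfolding Q_def by (intro lipschitz_unit_add lipschitz_unit_cmult lP lq)
  obtain KP where KP: "KP-lipschitz_on {0..1} P" using lP by blast
  obtain P' where P': "P' \<in> borel_measurable borel" "\<And>t. \<bar>P' t\<bar> \<le> KP"
    "AE t in lborel. t \<in> {0..1} \<longrightarrow> 0 < t \<and> t < 1 \<and> (P has_real_derivative P' t) (at t)"
    by (rule lipschitz_interval_derivative[OF KP]) (simp, blast)
  have g_cont: "continuous_on UNIV g" unfolding g_def using lip by (rule lipschitz_on_continuous_on)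
  \<comment> \<open>The primitive that makes the one-form of the area balance exact.\<close>
  define E where "E = (\<lambda>t. q t * P t + T / 2 * (P t * P t) - q t * p t + T / L * f (q t))"
  have ends: "q 1 = q 0" "p 1 = p 0" "N 1 = N 0" using closed by (simp_all add: q_def p_def N_def)
  have int_P: "set_integrable lebesgue {0..1} (\<lambda>t. Q t * P' t)"
    by (rule set_integrable_continuous_times_bounded[OF lipschitz_unit_continuous[OF lQ] P'(1,2)])
  have int_p: "set_integrable lebesgue {0..1} (\<lambda>t. q t * p' t)"
    by (rule set_integrable_continuous_times_bounded[OF lipschitz_unit_continuous[OF lq] p'(2,3)])
  have int_N: "set_integrable lebesgue {0..1} (\<lambda>t. N t * q' t)"
    by (rule set_integrable_continuous_times_bounded[OF lipschitz_unit_continuous[OF lN] q'(2,3)])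
  have "(LINT t:{0..1}|lebesgue. Q t * P' t - q t * p' t + T * (N t * q' t)) = 0"
  proof (rule loop_integral_derivative)
    have "lipschitz_unit (\<lambda>t. f (q t))"
      by (rule lipschitz_unit_C1_compose[OF f _ lq]) (rule g_cont[unfolded g_def])
    then show "lipschitz_unit E"
      unfolding E_def
      by (intro lipschitz_unit_add lipschitz_unit_diff lipschitz_unit_cmult lipschitz_unit_mult lP lq lp)
    show "E 1 = E 0" using ends by (simp add: E_def P_def)
    show "AE t in lborel. t \<in> {0..1} \<longrightarrow> (E has_real_derivative Q t * P' t - q t * p' t + T * (N t * q' t)) (at t)"
      using q'(4) p'(4) P'(3)
    proof eventually_elim
      case (elim t)
      show ?case
      proof
        assume "t \<in> {0..1}"
        then have d [derivative_intros]: "(q has_real_derivative q' t) (at t)" "(p has_real_derivative p' t) (at t)"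
          "(P has_real_derivative P' t) (at t)" using elim by auto
        have [derivative_intros]: "((\<lambda>t. f (q t)) has_real_derivative g (q t) * q' t) (at t)"
          unfolding g_def by (rule DERIV_chain2[OF f d(1)])
        have "(E has_real_derivative (q' t * P t + q t * P' t) + T / 2 * (P' t * P t + P t * P' t)
            - (q' t * p t + q t * p' t) + T / L * (g (q t) * q' t)) (at t)"
          unfolding E_def using L by (auto intro!: derivative_eq_intros)
        moreover have "(q' t * P t + q t * P' t) + T / 2 * (P' t * P t + P t * P' t)
            - (q' t * p t + q t * p' t) + T / L * (g (q t) * q' t)
            = Q t * P' t - q t * p' t + T * (N t * q' t)"
        proof -
          have "q' t * P t = q' t * p t - T / L * (g (q t) * q' t) + T * (N t * q' t)"
            by (simp add: P_def algebra_simps)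
          moreover have "Q t * P' t = q t * P' t + T * (P t * P' t)" by (simp add: Q_def algebra_simps)
          ultimately show ?thesis by (simp add: algebra_simps)
        qed
        ultimately show "(E has_real_derivative Q t * P' t - q t * p' t + T * (N t * q' t)) (at t)" by (rule DERIV_cong)
      qed
    qed
  qed
  then have sum: "(LINT t:{0..1}|lebesgue. Q t * P' t) - (LINT t:{0..1}|lebesgue. q t * p' t)
      + T * (LINT t:{0..1}|lebesgue. N t * q' t) = 0"
    using int_P int_p int_N by simp
  have "contour_area (psi f L \<kappa> T \<circ> \<gamma>) = (LINT t:{0..1}|lebesgue. Q t * P' t)"
    unfolding contour_area_def line_integral_dp_def psi_eq fst_conv
  proof (rule set_integral_lebesgue_AE_cong[OF int_P])
    show "AE t in lborel. t \<in> {0..1} \<longrightarrow>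
        Q t * snd (vector_derivative (\<lambda>t. (Q t, P t)) (at t within {0..1})) = Q t * P' t"
      using q'(4) P'(3)
    proof eventually_elim
      case (elim t)
      show ?case
      proof
        assume "t \<in> {0..1}"
        then have t: "0 < t" "t < 1" and d: "(q has_real_derivative q' t) (at t)"
          "(P has_real_derivative P' t) (at t)" using elim by auto
        have "(Q has_real_derivative q' t + T * P' t) (at t)"
          unfolding Q_def by (intro derivative_intros d DERIV_cmult)
        then have "((\<lambda>t. (Q t, P t)) has_vector_derivative (q' t + T * P' t, P' t)) (at t)"
          using d(2) unfolding has_real_derivative_iff_has_vector_derivative
          by (rule has_vector_derivative_Pair)
        then show "Q t * snd (vector_derivative (\<lambda>t. (Q t, P t)) (at t within {0..1})) = Q t * P' t"
          using t by (simp add: at_within_Icc_at vector_derivative_at)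
      qed
    qed
  qed
  moreover have "line_integral_dp \<gamma> fst = (LINT t:{0..1}|lebesgue. q t * p' t)"
    unfolding line_integral_dp_def
    by (rule set_integral_lebesgue_AE_cong[OF int_p]) (use p'(4) in eventually_elim, simp add: q_def)
  moreover have "line_integral_dq \<gamma> (f_NP f L \<kappa>) = (LINT t:{0..1}|lebesgue. N t * q' t)"
    unfolding line_integral_dq_def
    by (rule set_integral_lebesgue_AE_cong[OF int_N]) (use q'(4) in eventually_elim, simp add: N_def)
  ultimately show ?thesis using sum by simp
qed

text \<open>With \<open>u = q + \<beta> p\<close>, the forms \<open>f'(u) du\<close> and \<open>f'(q) dq\<close> are exact, hence
  \<open>f'(u) dq\<close> may be exchanged for \<open>- \<beta> f'(u) dp\<close> in a loop integral, and likewise \<open>p dq\<close> for \<open>- q dp\<close>.\<close>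

lemma line_integral_f_NP:
  fixes f :: "real \<Rightarrow> real" and \<gamma> :: "real \<Rightarrow> real \<times> real"
  assumes L: "L > 0" and f: "\<And>x. (f has_real_derivative deriv f x) (at x)"
    and lip: "K-lipschitz_on UNIV (deriv f)"
    and \<gamma>: "piecewise_C1_path \<gamma>" and closed: "\<gamma> 1 = \<gamma> 0"
  shows "line_integral_dq \<gamma> (f_NP f L \<kappa>) = 2 * damp \<kappa> * line_integral_dp \<gamma> fst
    + mom \<kappa> / L * line_integral_dp \<gamma> (\<lambda>z. deriv f (fst z + mom \<kappa> * snd z))"
proof -
  define g where "g = deriv f"
  define q where "q = (\<lambda>t. fst (\<gamma> t))"
  define p where "p = (\<lambda>t. snd (\<gamma> t))"
  define u where "u = (\<lambda>t. q t + mom \<kappa> * p t)"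
  define N where "N = (\<lambda>t. f_NP f L \<kappa> (\<gamma> t))"
  have N_eq: "N = (\<lambda>t. - 2 * damp \<kappa> * p t - 1 / L * (g (u t) - g (q t)))"
    by (simp add: N_def f_NP_def p_def q_def g_def u_def case_prod_beta)
  obtain Kq q' where q': "Kq-lipschitz_on {0..1} q" "q' \<in> borel_measurable borel" "\<And>t. \<bar>q' t\<bar> \<le> Kq"
    "AE t in lborel. t \<in> {0..1} \<longrightarrow> 0 < t \<and> t < 1 \<and> (q has_real_derivative q' t) (at t)
       \<and> fst (vector_derivative \<gamma> (at t within {0..1})) = q' t"
    unfolding q_def by (rule path_functional_derivative[OF \<gamma> bounded_linear_fst]) blast
  obtain Kp p' where p': "Kp-lipschitz_on {0..1} p" "p' \<in> borel_measurable borel" "\<And>t. \<bar>p' t\<bar> \<le> Kp"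
    "AE t in lborel. t \<in> {0..1} \<longrightarrow> 0 < t \<and> t < 1 \<and> (p has_real_derivative p' t) (at t)
       \<and> snd (vector_derivative \<gamma> (at t within {0..1})) = p' t"
    unfolding p_def by (rule path_functional_derivative[OF \<gamma> bounded_linear_snd]) blast
  have lq: "lipschitz_unit q" and lp: "lipschitz_unit p" using q'(1) p'(1) by blast+
  have lu: "lipschitz_unit u" unfolding u_def by (intro lipschitz_unit_add lipschitz_unit_cmult lp lq)
  have lg: "lipschitz_unit (\<lambda>t. g (v t))" if "lipschitz_unit v" for v
    unfolding g_def by (rule lipschitz_unit_compose[OF lip that])
  have lN: "lipschitz_unit N"
    unfolding N_eq by (intro lipschitz_unit_diff lipschitz_unit_cmult lg lu lp lq)
  have g_cont: "continuous_on UNIV g" unfolding g_def using lip by (rule lipschitz_on_continuous_on)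
  have lf: "lipschitz_unit (\<lambda>t. f (v t))" if "lipschitz_unit v" for v
    by (rule lipschitz_unit_C1_compose[OF f _ that]) (rule g_cont[unfolded g_def])
  \<comment> \<open>The primitive of the exact part of \<open>f\<^sub>N\<^sub>P dq\<close>.\<close>
  define E where "E = (\<lambda>t. - 2 * damp \<kappa> * (q t * p t) - 1 / L * f (u t) + 1 / L * f (q t))"
  have int_p: "set_integrable lebesgue {0..1} (\<lambda>t. q t * p' t)"
    by (rule set_integrable_continuous_times_bounded[OF lipschitz_unit_continuous[OF lq] p'(2,3)])
  have int_g: "set_integrable lebesgue {0..1} (\<lambda>t. g (u t) * p' t)"
    by (rule set_integrable_continuous_times_bounded[OF lipschitz_unit_continuous[OF lg[OF lu]] p'(2,3)])
  have int_N: "set_integrable lebesgue {0..1} (\<lambda>t. N t * q' t)"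
    by (rule set_integrable_continuous_times_bounded[OF lipschitz_unit_continuous[OF lN] q'(2,3)])
  have "(LINT t:{0..1}|lebesgue. N t * q' t - 2 * damp \<kappa> * (q t * p' t) - mom \<kappa> / L * (g (u t) * p' t)) = 0"
  proof (rule loop_integral_derivative)
    show "lipschitz_unit E"
      unfolding E_def
      by (intro lipschitz_unit_add lipschitz_unit_diff lipschitz_unit_cmult lipschitz_unit_mult lf lu lq lp)
    show "E 1 = E 0" using closed by (simp add: E_def u_def q_def p_def)
    show "AE t in lborel. t \<in> {0..1} \<longrightarrow>
      (E has_real_derivative N t * q' t - 2 * damp \<kappa> * (q t * p' t) - mom \<kappa> / L * (g (u t) * p' t)) (at t)"
      using q'(4) p'(4)
    proof eventually_elim
      case (elim t)
      show ?case
      proof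
        assume "t \<in> {0..1}"
        then have d [derivative_intros]: "(q has_real_derivative q' t) (at t)" "(p has_real_derivative p' t) (at t)"
          using elim by auto
        have du: "(u has_real_derivative q' t + mom \<kappa> * p' t) (at t)"
          unfolding u_def by (intro derivative_intros d DERIV_cmult)
        have [derivative_intros]: "((\<lambda>t. f (q t)) has_real_derivative g (q t) * q' t) (at t)"
          "((\<lambda>t. f (u t)) has_real_derivative g (u t) * (q' t + mom \<kappa> * p' t)) (at t)"
          unfolding g_def by (rule DERIV_chain2[OF f d(1)], rule DERIV_chain2[OF f du])
        have "(E has_real_derivative - 2 * damp \<kappa> * (q' t * p t + q t * p' t)
            - 1 / L * (g (u t) * (q' t + mom \<kappa> * p' t)) + 1 / L * (g (q t) * q' t)) (at t)"
          unfolding E_def using L by (auto intro!: derivative_eq_intros)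
        moreover have "- 2 * damp \<kappa> * (q' t * p t + q t * p' t)
            - 1 / L * (g (u t) * (q' t + mom \<kappa> * p' t)) + 1 / L * (g (q t) * q' t)
            = N t * q' t - 2 * damp \<kappa> * (q t * p' t) - mom \<kappa> / L * (g (u t) * p' t)"
          by (simp add: N_eq algebra_simps add_divide_distrib diff_divide_distrib)
        ultimately show "(E has_real_derivative N t * q' t - 2 * damp \<kappa> * (q t * p' t)
            - mom \<kappa> / L * (g (u t) * p' t)) (at t)" by simp
      qed
    qed
  qed
  then have sum: "(LINT t:{0..1}|lebesgue. N t * q' t) - 2 * damp \<kappa> * (LINT t:{0..1}|lebesgue. q t * p' t)
      - mom \<kappa> / L * (LINT t:{0..1}|lebesgue. g (u t) * p' t) = 0"
    using int_N int_p int_g by simp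
  have "line_integral_dp \<gamma> fst = (LINT t:{0..1}|lebesgue. q t * p' t)"
    unfolding line_integral_dp_def
    by (rule set_integral_lebesgue_AE_cong[OF int_p]) (use p'(4) in eventually_elim, simp add: q_def)
  moreover have "line_integral_dp \<gamma> (\<lambda>z. deriv f (fst z + mom \<kappa> * snd z)) = (LINT t:{0..1}|lebesgue. g (u t) * p' t)"
    unfolding line_integral_dp_def
    by (rule set_integral_lebesgue_AE_cong[OF int_g])
      (use p'(4) in eventually_elim, simp add: g_def u_def q_def p_def)
  moreover have "line_integral_dq \<gamma> (f_NP f L \<kappa>) = (LINT t:{0..1}|lebesgue. N t * q' t)"
    unfolding line_integral_dq_def
    by (rule set_integral_lebesgue_AE_cong[OF int_N]) (use q'(4) in eventually_elim, simp add: N_def)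
  ultimately show ?thesis using sum by simp
qed

theorem proposition4p1:
  fixes f :: "real \<Rightarrow> real" and L \<kappa> T :: real and \<gamma> :: "real \<Rightarrow> real \<times> real"
  assumes "L > 0" and "\<kappa> \<ge> 1" and "T > 0"
    and "\<forall>x. f differentiable (at x)"
    and "L-lipschitz_on UNIV (deriv f)"
    and "strongly_convex f L \<kappa>"
    and "\<forall>x. f 0 \<le> f x" and "f 0 = 0"
    and "simple_closed_contour \<gamma>"
  shows "contour_area (psi f L \<kappa> T \<circ> \<gamma>) - enclosed_area \<gamma>
           = - T * line_integral_dq \<gamma> (f_NP f L \<kappa>)
       \<and> - T * line_integral_dq \<gamma> (f_NP f L \<kappa>)
           = - T * area_form_integral \<gamma>
               (\<lambda>(q, p). 2 * damp \<kappa> + mom \<kappa> / L * deriv (deriv f) (q + mom \<kappa> * p))"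
proof -
  define \<Gamma> where "\<Gamma> = inside (path_image \<gamma>)"
  have f: "(f has_real_derivative deriv f x) (at x)" for x
    using assms(4) by (simp add: DERIV_deriv_iff_real_differentiable)
  have \<gamma>: "piecewise_C1_path \<gamma>" and closed: "\<gamma> 1 = \<gamma> 0"
    using assms(9) by (auto simp: simple_closed_contour_def pathfinish_def pathstart_def)
  have id: "1-lipschitz_on UNIV (\<lambda>x::real. x)" by (rule lipschitz_on_id)
  \<comment> \<open>Green's theorem for \<open>g(q) = q\<close> and for \<open>g = f'\<close>.\<close>
  have area: "line_integral_dp \<gamma> fst = enclosed_area \<gamma>"
    using green_lipschitz(2)[OF assms(9) id, of 0] by (simp add: enclosed_area_def)
  have hess: "line_integral_dp \<gamma> (\<lambda>z. deriv f (fst z + mom \<kappa> * snd z))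
      = area_form_integral \<gamma> (\<lambda>z. deriv (deriv f) (fst z + mom \<kappa> * snd z))"
    by (rule green_lipschitz(2)[OF assms(9,5)])
  have int1: "set_integrable lebesgue \<Gamma> (\<lambda>z. 2 * damp \<kappa> * 1)"
    using green_lipschitz(1)[OF assms(9) id, of 0] unfolding \<Gamma>_def
    by (intro set_integrable_mult_right) simp
  have int2: "set_integrable lebesgue \<Gamma> (\<lambda>z. mom \<kappa> / L * deriv (deriv f) (fst z + mom \<kappa> * snd z))"
    unfolding \<Gamma>_def by (intro set_integrable_mult_right impI green_lipschitz(1)[OF assms(9,5)])
  have "area_form_integral \<gamma> (\<lambda>(q, p). 2 * damp \<kappa> + mom \<kappa> / L * deriv (deriv f) (q + mom \<kappa> * p))
    = (if counter_clockwise \<gamma> then 1 else - 1) * ((LINT z:\<Gamma>|lebesgue. 2 * damp \<kappa> * 1)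
      + (LINT z:\<Gamma>|lebesgue. mom \<kappa> / L * deriv (deriv f) (fst z + mom \<kappa> * snd z)))"
    unfolding area_form_integral_def \<Gamma>_def[symmetric] case_prod_beta
    by (subst set_integral_add(2)[OF int1 int2, symmetric]) simp
  also have "\<dots> = 2 * damp \<kappa> * enclosed_area \<gamma>
      + mom \<kappa> / L * area_form_integral \<gamma> (\<lambda>z. deriv (deriv f) (fst z + mom \<kappa> * snd z))"
    unfolding area_form_integral_def enclosed_area_def \<Gamma>_def[symmetric] set_integral_mult_right
    by (simp add: algebra_simps)
  also have "\<dots> = line_integral_dq \<gamma> (f_NP f L \<kappa>)"
    using line_integral_f_NP[OF assms(1) f assms(5) \<gamma> closed, of \<kappa>] by (simp add: area hess)
  finally have "line_integral_dq \<gamma> (f_NP f L \<kappa>) = area_form_integral \<gamma>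
      (\<lambda>(q, p). 2 * damp \<kappa> + mom \<kappa> / L * deriv (deriv f) (q + mom \<kappa> * p))" by simp
  moreover have "contour_area (psi f L \<kappa> T \<circ> \<gamma>) - enclosed_area \<gamma> = - T * line_integral_dq \<gamma> (f_NP f L \<kappa>)"
    using contour_area_psi[OF assms(1) f assms(5) \<gamma> closed, of \<kappa> T] by (simp add: area)
  ultimately show ?thesis by simp
qed

end
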